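(* For all integers $\widetilde d > d \geq 2$ and all real $\xi\geq 0$, the set-to-set distance exponents of Liouville first passage percolation satisfy $\lambda(\widetilde d,\xi)\geq\lambda(d,\xi)$.
   Context: Log-correlated field. For $d\ge 2$, let $h$ be the whole-space log-correlated Gaussian field (LGF) on $\mathbb{R}^d$: the centered Gaussian random generalized function, a priori defined modulo additive constant, with $\mathrm{Cov}[(h,f_1),(h,f_2)] = \int_{\mathbb{R}^d\times\mathbb{R}^d} f_1(x)f_2(y)\log\frac{1}{|x-y|}\,dx\,dy$ for Schwartz functions $f_1,f_2$ with average $0$. The additive constant is fixed by requiring the average of $h$ over the unit sphere to be $0$. Equivalently, with $\sigma$ the uniform probability measure on the unit sphere, for a suitable probability measure $\mu$ (one with finite logarithmic energy) the variable $(h,\mu)$ is interpreted as $(h,\mu-\sigma)$, where the covariance formula above extends to signed measures of total mass $0$ with finite logarithmic energy. Mollification. For $\epsilon>0$ and $x\in\mathbb{R}^d$, $h_\epsilon(x)$ is the average of $h$ over the box $x+[-\epsilon,\epsilon]^d$. LFPP. For $\xi\ge 0$ and a discrete (nearest-neighbor) path $P:\{1,\dots,N\}\to\epsilon\mathbb{Z}^d$, set $L_h^{\epsilon,\xi}(P) := \sum_{i=1}^N \epsilon\, e^{\xi h_\epsilon(P(i))}$. For $A\subset\epsilon\mathbb{Z}^d$ and $z,w\in A$, let $D_h^{\epsilon,\xi}(z,w;A)$ be the infimum of $L_h^{\epsilon,\xi}(P)$ over discrete paths $P$ from $z$ to $w$ staying in $A$; for sets $U,V\subset A$, $D_h^{\epsilon,\xi}(U,V;A)$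 is the infimum over $z\in U$, $w\in V$. Distance exponent. Let $S^\epsilon=[0,1]^d\cap\epsilon\mathbb{Z}^d$, $\partial_L S^\epsilon = (\{0\}\times[0,1]^{d-1})\cap\epsilon\mathbb{Z}^d$, $\partial_R S^\epsilon = (\{1\}\times[0,1]^{d-1})\cap\epsilon\mathbb{Z}^d$. Define $$\lambda(d,\xi) := \sup\left\{\alpha\in\mathbb{R} : \liminf_{\epsilon\to0}\mathbb{P}\left[D_h^{\epsilon,\xi}(\partial_L S^\epsilon,\partial_R S^\epsilon;S^\epsilon)\leq\epsilon^\alpha\right]=1\right\},$$ where $\epsilon\to0$ along values with $\epsilon^{-1}\in\mathbb{N}$. *)

theory Defs
  imports "HOL-Probability.Probability"
begin

section \<open>Signed measures of total mass zero with finite logarithmic energy\<close>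

text \<open>A pair \<open>(\<mu>, \<nu>)\<close> of finite Borel measures stands for the signed measure \<open>\<mu> - \<nu>\<close>.\<close>

type_synonym 'a signed_pair = "'a measure \<times> 'a measure"

text \<open>The logarithm is singular on the diagonal, whereas \<open>ln 0 = 0\<close> in HOL; the value \<open>\<infinity>\<close> is
  therefore put there by hand (so that, e.g., measures with atoms have infinite energy).\<close>

definition finite_log_energy :: "'a::euclidean_space measure \<Rightarrow> bool" where
  "finite_log_energy \<mu> \<longleftrightarrow>
     (\<integral>\<^sup>+ p. (if fst p = snd p then \<infinity> else ennreal \<bar>ln (dist (fst p) (snd p))\<bar>) \<partial>(\<mu> \<Otimes>\<^sub>M \<mu>)) < \<infinity>"

definition zero_mass_pairs :: "'a::euclidean_space signed_pair set" where
  "zero_mass_pairs = {(\<mu>, \<nu>).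
     sets \<mu> = sets borel \<and> sets \<nu> = sets borel \<and>
     finite_measure \<mu> \<and> finite_measure \<nu> \<and>
     finite_log_energy \<mu> \<and> finite_log_energy \<nu> \<and>
     emeasure \<mu> UNIV = emeasure \<nu> UNIV}"

text \<open>The diagonal is a null set for the product of two measures of finite logarithmic energy,
  so the value of the integrand there is irrelevant.\<close>

definition log_energy :: "'a::euclidean_space measure \<Rightarrow> 'a measure \<Rightarrow> real" where
  "log_energy \<mu> \<nu> = (\<integral>p. ln (1 / dist (fst p) (snd p)) \<partial>(\<mu> \<Otimes>\<^sub>M \<nu>))"

definition log_covariance :: "'a::euclidean_space signed_pair \<Rightarrow> 'a signed_pair \<Rightarrow> real" where
  "log_covariance \<rho> \<tau> =
     log_energy (fst \<rho>) (fst \<tau>) - log_energy (fst \<rho>) (snd \<tau>)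
   - log_energy (snd \<rho>) (fst \<tau>) + log_energy (snd \<rho>) (snd \<tau>)"


section \<open>Schwartz functions of average zero\<close>

fun iter_deriv :: "'a::euclidean_space list \<Rightarrow> ('a \<Rightarrow> real) \<Rightarrow> 'a \<Rightarrow> real" where
  "iter_deriv [] f = f"
| "iter_deriv (v # vs) f = (\<lambda>x. frechet_derivative (iter_deriv vs f) (at x) v)"

definition schwartz :: "('a::euclidean_space \<Rightarrow> real) set" where
  "schwartz = {f. \<forall>vs. set vs \<subseteq> Basis \<longrightarrow>
     (\<forall>x. iter_deriv vs f differentiable (at x)) \<and>
     (\<forall>k::nat. bounded (range (\<lambda>x. (1 + norm x) ^ k * iter_deriv vs f x)))}"

definition schwartz_seminorm :: "nat \<Rightarrow> ('a::euclidean_space \<Rightarrow> real) \<Rightarrow> real" where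
  "schwartz_seminorm k f =
     (SUP (vs, x) \<in> {vs. set vs \<subseteq> Basis \<and> length vs \<le> k} \<times> UNIV.
        (1 + norm x) ^ k * \<bar>iter_deriv vs f x\<bar>)"

definition schwartz0 :: "('a::euclidean_space \<Rightarrow> real) set" where
  "schwartz0 = {f \<in> schwartz. integral\<^sup>L lborel f = 0}"

text \<open>The signed measure \<open>f(x) dx\<close>, written as a pair by splitting \<open>f\<close> into its positive and
  negative parts (\<open>ennreal\<close> truncates negative reals to \<open>0\<close>).\<close>

definition function_pair :: "('a::euclidean_space \<Rightarrow> real) \<Rightarrow> 'a signed_pair" where
  "function_pair f = (density lborel (\<lambda>x. ennreal (f x)), density lborel (\<lambda>x. ennreal (- f x)))"

text \<open>A linear functional on a space topologised by an increasing sequence of seminorms is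
  continuous iff it is dominated by a multiple of one of them. Functionals on \<open>schwartz0\<close> are the
  tempered distributions modulo additive constants.\<close>

definition distribution_mod_const :: "(('a::euclidean_space \<Rightarrow> real) \<Rightarrow> real) \<Rightarrow> bool" where
  "distribution_mod_const T \<longleftrightarrow>
     (\<forall>f\<in>schwartz0. \<forall>g\<in>schwartz0. \<forall>a b. T (\<lambda>x. a * f x + b * g x) = a * T f + b * T g) \<and>
     (\<exists>C k. \<forall>f\<in>schwartz0. \<bar>T f\<bar> \<le> C * schwartz_seminorm k f)"


section \<open>The log-correlated Gaussian field\<close>

text \<open>Degenerate Gaussian variables (variance \<open>0\<close>) are included.\<close>

definition centered_gaussian :: "'w measure \<Rightarrow> ('w \<Rightarrow> real) \<Rightarrow> bool" where
  "centered_gaussian M X \<longleftrightarrow> X \<in> borel_measurable M \<and>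
     ((AE \<omega> in M. X \<omega> = 0) \<or> (\<exists>s>0. distributed M lborel X (\<lambda>x. ennreal (normal_density 0 s x))))"

definition centered_gaussian_process :: "'w measure \<Rightarrow> 'i set \<Rightarrow> ('i \<Rightarrow> 'w \<Rightarrow> real) \<Rightarrow> bool" where
  "centered_gaussian_process M I X \<longleftrightarrow>
     (\<forall>J c. finite J \<and> J \<subseteq> I \<longrightarrow> centered_gaussian M (\<lambda>\<omega>. \<Sum>i\<in>J. c i * X i \<omega>))"

definition covariance :: "'w measure \<Rightarrow> ('w \<Rightarrow> real) \<Rightarrow> ('w \<Rightarrow> real) \<Rightarrow> real" where
  "covariance M X Y = (\<integral>\<omega>. (X \<omega> - integral\<^sup>L M X) * (Y \<omega> - integral\<^sup>L M Y) \<partial>M)"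

text \<open>\<open>h (\<mu>, \<nu>)\<close> is the random variable \<open>(h, \<mu> - \<nu>)\<close>. Only signed measures of total mass zero are
  tested against, so \<open>h\<close> is the field modulo additive constant. The pairings with the Schwartz
  functions of average zero are those at \<open>function_pair f\<close>; the other pairings are their extension
  to signed measures of finite logarithmic energy, with the same covariance formula. The last
  clause says that \<open>h\<close> is a random generalized function. These conditions determine the joint law
  of all the pairings.\<close>

definition whole_space_LGF ::
    "'w measure \<Rightarrow> ('a::euclidean_space signed_pair \<Rightarrow> 'w \<Rightarrow> real) \<Rightarrow> bool" where
  "whole_space_LGF M h \<longleftrightarrow>
     prob_space M \<and>
     centered_gaussian_process M zero_mass_pairs h \<and>
     (\<forall>\<rho>\<in>zero_mass_pairs. \<forall>\<tau>\<in>zero_mass_pairs. covariance M (h \<rho>) (h \<tau>) = log_covariance \<rho> \<tau>) \<and>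
     (AE \<omega> in M. distribution_mod_const (\<lambda>f. h (function_pair f) \<omega>))"

text \<open>The image of the uniform distribution on the unit ball under \<open>x \<mapsto> x / |x|\<close>.\<close>

definition sphere_unif :: "'a::euclidean_space measure" where
  "sphere_unif = distr (uniform_measure lborel (ball 0 1)) borel (\<lambda>x. x /\<^sub>R norm x)"

text \<open>\<open>(h, \<mu>)\<close> for a probability measure \<open>\<mu>\<close>, the additive constant being fixed by requiring
  that the average of \<open>h\<close> over the unit sphere is \<open>0\<close>.\<close>

definition pairing :: "('a::euclidean_space signed_pair \<Rightarrow> 'w \<Rightarrow> real) \<Rightarrow> 'a measure \<Rightarrow> 'w \<Rightarrow> real" where
  "pairing h \<mu> = h (\<mu>, sphere_unif)"

definition box_average ::
    "((real^'n) signed_pair \<Rightarrow> 'w \<Rightarrow> real) \<Rightarrow> real \<Rightarrow> real^'n \<Rightarrow> 'w \<Rightarrow> real" where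
  "box_average h \<epsilon> x = pairing h (uniform_measure lborel (cbox (x - (\<chi> i. \<epsilon>)) (x + (\<chi> i. \<epsilon>))))"


section \<open>Liouville first passage percolation\<close>

definition scaled_lattice :: "real \<Rightarrow> (real^'n) set" where
  "scaled_lattice \<epsilon> = {x. \<forall>i. \<exists>k::int. x $ i = \<epsilon> * of_int k}"

text \<open>A path \<open>P : {1,\<dots>,N} \<rightarrow> A\<close> is the list of its \<open>N\<close> values; two points of the lattice are
  nearest neighbours iff their Euclidean distance is the mesh size.\<close>

definition lattice_path :: "real \<Rightarrow> (real^'n) set \<Rightarrow> real^'n \<Rightarrow> real^'n \<Rightarrow> (real^'n) list \<Rightarrow> bool" where
  "lattice_path \<epsilon> A z w P \<longleftrightarrow>
     P \<noteq> [] \<and> hd P = z \<and> last P = w \<and> set P \<subseteq> A \<and>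
     (\<forall>i. Suc i < length P \<longrightarrow> dist (P ! i) (P ! Suc i) = \<epsilon>)"

definition lfpp_length ::
    "((real^'n) signed_pair \<Rightarrow> 'w \<Rightarrow> real) \<Rightarrow> real \<Rightarrow> real \<Rightarrow> 'w \<Rightarrow> (real^'n) list \<Rightarrow> real" where
  "lfpp_length h \<epsilon> \<xi> \<omega> P = (\<Sum>x\<leftarrow>P. \<epsilon> * exp (\<xi> * box_average h \<epsilon> x \<omega>))"

definition lfpp_dist ::
    "((real^'n) signed_pair \<Rightarrow> 'w \<Rightarrow> real) \<Rightarrow> real \<Rightarrow> real \<Rightarrow> 'w \<Rightarrow>
     real^'n \<Rightarrow> real^'n \<Rightarrow> (real^'n) set \<Rightarrow> ereal" where
  "lfpp_dist h \<epsilon> \<xi> \<omega> z w A = (INF P \<in> Collect (lattice_path \<epsilon> A z w). ereal (lfpp_length h \<epsilon> \<xi> \<omega> P))"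

definition lfpp_set_dist ::
    "((real^'n) signed_pair \<Rightarrow> 'w \<Rightarrow> real) \<Rightarrow> real \<Rightarrow> real \<Rightarrow> 'w \<Rightarrow>
     (real^'n) set \<Rightarrow> (real^'n) set \<Rightarrow> (real^'n) set \<Rightarrow> ereal" where
  "lfpp_set_dist h \<epsilon> \<xi> \<omega> U V A = (INF z\<in>U. INF w\<in>V. lfpp_dist h \<epsilon> \<xi> \<omega> z w A)"

definition unit_cube :: "real \<Rightarrow> (real^'n) set" where
  "unit_cube \<epsilon> = {x. \<forall>i. 0 \<le> x $ i \<and> x $ i \<le> 1} \<inter> scaled_lattice \<epsilon>"

text \<open>The coordinates are ordered by the index type; the first one is the least element.\<close>

definition left_face :: "real \<Rightarrow> (real^'n::{finite,linorder}) set" where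
  "left_face \<epsilon> = {x \<in> unit_cube \<epsilon>. x $ Min UNIV = 0}"

definition right_face :: "real \<Rightarrow> (real^'n::{finite,linorder}) set" where
  "right_face \<epsilon> = {x \<in> unit_cube \<epsilon>. x $ Min UNIV = 1}"

definition crossing_prob ::
    "'w measure \<Rightarrow> ((real^'n::{finite,linorder}) signed_pair \<Rightarrow> 'w \<Rightarrow> real) \<Rightarrow>
     real \<Rightarrow> real \<Rightarrow> real \<Rightarrow> real" where
  "crossing_prob M h \<xi> \<alpha> \<epsilon> = measure M {\<omega> \<in> space M.
     lfpp_set_dist h \<epsilon> \<xi> \<omega> (left_face \<epsilon>) (right_face \<epsilon>) (unit_cube \<epsilon>) \<le> ereal (\<epsilon> powr \<alpha>)}"

text \<open>The exponent \<open>\<lambda>(d, \<xi>)\<close> with \<open>d = CARD('n)\<close>, computed from a realisation \<open>(M, h)\<close> of the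
  field; it depends only on the law of \<open>h\<close>, hence only on \<open>d\<close> and \<open>\<xi>\<close>.\<close>

definition lfpp_exponent ::
    "'w measure \<Rightarrow> ((real^'n::{finite,linorder}) signed_pair \<Rightarrow> 'w \<Rightarrow> real) \<Rightarrow> real \<Rightarrow> ereal" where
  "lfpp_exponent M h \<xi> = (SUP \<alpha> \<in> {\<alpha>::real.
     Liminf (at 0 within {\<epsilon>. 0 < \<epsilon> \<and> 1 / \<epsilon> \<in> \<nat>}) (\<lambda>\<epsilon>. ereal (crossing_prob M h \<xi> \<alpha> \<epsilon>)) = 1}. ereal \<alpha>)"

end

theory Submission
  imports Defs
begin

text \<open>Write \<open>n = CARD('n)\<close> and \<open>m = CARD('m)\<close>, and embed \<open>\<real>\<^sup>n\<close> isometrically into \<open>\<real>\<^sup>m\<close> along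
coordinate axes, by a map \<open>\<iota>\<close> that sends the first axis to the first axis. The covariance of the
field is the kernel \<open>log (1 / |x - y|)\<close> in every dimension, and this kernel only sees distances.
Hence the \<open>m\<close>-dimensional field, tested against measures carried by the image of \<open>\<iota>\<close>, is a
realisation of the \<open>n\<close>-dimensional field. Because \<open>\<iota>\<close> maps left-right lattice crossings of the
\<open>n\<close>-dimensional cube to left-right lattice crossings of the \<open>m\<close>-dimensional one, passing to the
higher dimension only adds crossings, and the crossing distance should not increase.

What has to be paid for is the mollification. At an embedded lattice point the percolation weights
use the average over an \<open>m\<close>-dimensional box, whereas the restricted field is averaged over the flat
\<open>n\<close>-dimensional box; the additive constants are also fixed by spheres of different dimensions. Both
boxes have side comparable to \<open>\<epsilon>\<close> and the same centre, so all energies between them are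
\<open>log (1 / \<epsilon>) + O(1)\<close> and the logarithms cancel in the variance of the difference
(\<open>box_average_increment_bounded\<close>). A union bound over the \<open>O(\<epsilon>\<^sup>-\<^sup>n)\<close> lattice points with the
Gaussian tail then bounds all these differences by \<open>\<delta> log (1 / \<epsilon>)\<close> with probability
\<open>1 - O(\<epsilon>)\<close>, for every \<open>\<delta> > 0\<close>. On that event the distance grows by a factor
of at most \<open>\<epsilon>\<^sup>-\<^sup>\<xi>\<^sup>\<delta>\<close> (\<open>crossing_prob_le_higher_dimension\<close>), so an
admissible exponent \<open>\<alpha>\<close> in dimension \<open>n\<close> gives the admissible exponent \<open>\<alpha> - \<xi> \<delta>\<close> in dimension
\<open>m\<close>, and \<open>\<delta>\<close> is arbitrary.

Three ingredients are of independent interest. A centred Gaussian vector has its law determined by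
its covariance (\<open>gaussian_law_determined_by_covariance\<close>); this rests on a uniqueness theorem for
joint laws tested against cosines (\<open>joint_law_eqI_cos\<close>). A compactly supported probability measure
whose mass on balls grows at most linearly with the radius has finite logarithmic energy, with a
bound that scales correctly (\<open>nn_integral_log_kernel_le\<close>). Finally, the uniform measures on
boxes, on flat boxes and, in dimension at least two, on the unit sphere have such linear growth.\<close>

section \<open>Centred Gaussian variables\<close>

lemma centered_gaussian_cases:
  assumes "prob_space M" "centered_gaussian M X"
  obtains (degenerate) "AE \<omega> in M. X \<omega> = 0" "(\<integral>\<omega>. (X \<omega>)\<^sup>2 \<partial>M) = 0"
  | (normal) s where "s > 0" "distributed M lborel X (\<lambda>x. ennreal (normal_density 0 s x))"
      "(\<integral>\<omega>. (X \<omega>)\<^sup>2 \<partial>M) = s\<^sup>2"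
proof -
  interpret prob_space M by fact
  have [measurable]: "X \<in> borel_measurable M"
    using assms(2) by (simp add: centered_gaussian_def)
  consider "AE \<omega> in M. X \<omega> = 0" | s where "s > 0"
    "distributed M lborel X (\<lambda>x. ennreal (normal_density 0 s x))"
    using assms(2) by (auto simp: centered_gaussian_def)
  then show thesis
  proof cases
    case 1
    have "(\<integral>\<omega>. (X \<omega>)\<^sup>2 \<partial>M) = (\<integral>\<omega>. 0 \<partial>M)"
      by (rule integral_cong_AE) (use 1 in auto)
    with 1 degenerate show thesis by simp
  next
    case 2
    have "(\<integral>\<omega>. (X \<omega>)\<^sup>2 \<partial>M) = s\<^sup>2"
      using normal_distributed_variance[OF 2] normal_distributed_expectation[OF 2] by simp
    with 2 normal show thesis by simp
  qed
qed

lemma centered_gaussian_integrable: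
  assumes "prob_space M" "centered_gaussian M X"
  shows "integrable M (\<lambda>\<omega>. (X \<omega>)\<^sup>2)" "integrable M X" "(\<integral>\<omega>. X \<omega> \<partial>M) = 0"
proof -
  interpret prob_space M by fact
  have [measurable]: "X \<in> borel_measurable M"
    using assms(2) by (simp add: centered_gaussian_def)
  have "integrable M (\<lambda>\<omega>. (X \<omega>)\<^sup>2) \<and> integrable M X \<and> (\<integral>\<omega>. X \<omega> \<partial>M) = 0"
    using assms
  proof (cases rule: centered_gaussian_cases)
    case degenerate
    have "integrable M (\<lambda>\<omega>. (X \<omega>)\<^sup>2) \<longleftrightarrow> integrable M (\<lambda>\<omega>. 0::real)"
      by (rule integrable_cong_AE) (use degenerate in auto)
    moreover have "integrable M X \<longleftrightarrow> integrable M (\<lambda>\<omega>. 0::real)"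
      by (rule integrable_cong_AE) (use degenerate in auto)
    moreover have "(\<integral>\<omega>. X \<omega> \<partial>M) = (\<integral>\<omega>. 0 \<partial>M)"
      by (rule integral_cong_AE) (use degenerate in auto)
    ultimately show ?thesis by simp
  next
    case (normal s)
    have "integrable lborel (\<lambda>x. normal_density 0 s x * (x - 0)^2)"
      "integrable lborel (\<lambda>x. normal_density 0 s x * (x - 0)^1)"
      using normal(1) by (intro integrable_normal_moment; simp)+
    then show ?thesis
      using distributed_integrable[OF normal(2), of "\<lambda>x. x\<^sup>2"]
        distributed_integrable[OF normal(2), of "\<lambda>x. x"]
        normal_distributed_expectation[OF normal(1,2)] by simp
  qed
  then show "integrable M (\<lambda>\<omega>. (X \<omega>)\<^sup>2)" "integrable M X" "(\<integral>\<omega>. X \<omega> \<partial>M) = 0"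
    by auto
qed

lemma centered_gaussian_law_eq:
  assumes "prob_space M" "centered_gaussian M X" "prob_space N" "centered_gaussian N Y"
    and eq: "(\<integral>\<omega>. (X \<omega>)\<^sup>2 \<partial>M) = (\<integral>\<omega>. (Y \<omega>)\<^sup>2 \<partial>N)"
  shows "distr M borel X = distr N borel Y"
proof -
  interpret M: prob_space M by fact
  interpret N: prob_space N by fact
  have [measurable]: "X \<in> borel_measurable M" "Y \<in> borel_measurable N"
    using assms(2,4) by (simp_all add: centered_gaussian_def)
  have zero: "distr M' borel Z = distr M' borel (\<lambda>_. 0)"
    if "AE \<omega> in M'. Z \<omega> = 0" "Z \<in> borel_measurable M'" for M' :: "'c measure" and Z :: "'c \<Rightarrow> real"
    using that by (intro distr_cong_AE) auto
  have const: "distr M borel (\<lambda>_. 0::real) = distr N borel (\<lambda>_. 0)"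
    by (intro measure_eqI) (auto simp: emeasure_distr M.emeasure_space_1 N.emeasure_space_1)
  show ?thesis
    using assms(1,2)
  proof (cases rule: centered_gaussian_cases)
    case degX: degenerate
    show ?thesis
      using assms(3,4)
    proof (cases rule: centered_gaussian_cases)
      case degenerate
      then show ?thesis using zero[OF degX(1)] zero[OF degenerate(1)] const by simp
    next
      case (normal s)
      then show ?thesis using eq degX by simp
    qed
  next
    case (normal s)
    note X = normal
    show ?thesis
      using assms(3,4)
    proof (cases rule: centered_gaussian_cases)
      case degenerate
      then show ?thesis using eq X by simp
    next
      case (normal s')
      have "s = s'" using X normal eq by (simp add: power2_eq_iff_nonneg)
      have "distr M borel X = distr M lborel X" "distr N borel Y = distr N lborel Y"
        by (intro distr_cong; simp)+
      then show ?thesis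
        using X(2) normal(2) \<open>s = s'\<close> by (simp add: distributed_def)
    qed
  qed
qed

text \<open>The exponential moment is found by completing the square, which recentres the density at \<open>u s\<^sup>2\<close>.\<close>

lemma nn_integral_exp_normal:
  assumes s: "s > 0"
  shows "(\<integral>\<^sup>+x. ennreal (normal_density 0 s x) * ennreal (exp (u * x)) \<partial>lborel)
    = ennreal (exp (u\<^sup>2 * s\<^sup>2 / 2))"
proof -
  have eq: "normal_density 0 s x * exp (u * x)
      = exp (u\<^sup>2 * s\<^sup>2 / 2) * normal_density (u * s\<^sup>2) s x" for x
  proof -
    have "- x\<^sup>2 / (2 * s\<^sup>2) + u * x = u\<^sup>2 * s\<^sup>2 / 2 + - (x - u * s\<^sup>2)\<^sup>2 / (2 * s\<^sup>2)"
      using s by (simp add: field_simps power2_eq_square)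
    then have "exp (- x\<^sup>2 / (2 * s\<^sup>2)) * exp (u * x)
      = exp (u\<^sup>2 * s\<^sup>2 / 2) * exp (- (x - u * s\<^sup>2)\<^sup>2 / (2 * s\<^sup>2))"
      by (simp only: exp_add[symmetric])
    then show ?thesis
      by (simp add: normal_density_def)
  qed
  have "(\<integral>\<^sup>+x. ennreal (normal_density 0 s x) * ennreal (exp (u * x)) \<partial>lborel)
      = (\<integral>\<^sup>+x. ennreal (exp (u\<^sup>2 * s\<^sup>2 / 2)) * ennreal (normal_density (u * s\<^sup>2) s x) \<partial>lborel)"
    by (simp add: ennreal_mult'[symmetric] eq)
  also have "\<dots> = ennreal (exp (u\<^sup>2 * s\<^sup>2 / 2))"
    using s by (simp add: nn_integral_cmult nn_integral_eq_integral)
  finally show ?thesis .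
qed

text \<open>The exponential Markov inequality. The parameter \<open>u\<close> is left free, so that a union bound can choose
it to beat any given power of the number of variables.\<close>

lemma centered_gaussian_tail:
  assumes "prob_space M" "centered_gaussian M X"
    and v: "(\<integral>\<omega>. (X \<omega>)\<^sup>2 \<partial>M) \<le> v" and u: "0 \<le> u"
  shows "measure M {\<omega> \<in> space M. t < X \<omega>} \<le> exp (u\<^sup>2 * v / 2 - u * t)"
proof -
  interpret prob_space M by fact
  have [measurable]: "X \<in> borel_measurable M"
    using assms(2) by (simp add: centered_gaussian_def)
  let ?V = "\<integral>\<omega>. (X \<omega>)\<^sup>2 \<partial>M"
  have mgf: "(\<integral>\<^sup>+\<omega>. ennreal (exp (u * X \<omega>)) \<partial>M) = ennreal (exp (u\<^sup>2 * ?V / 2))"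
    using assms(1,2)
  proof (cases rule: centered_gaussian_cases)
    case degenerate
    have "(\<integral>\<^sup>+\<omega>. ennreal (exp (u * X \<omega>)) \<partial>M) = (\<integral>\<^sup>+\<omega>. 1 \<partial>M)"
      by (rule nn_integral_cong_AE) (use degenerate in auto)
    with degenerate(2) show ?thesis by (simp add: emeasure_space_1)
  next
    case (normal s)
    have "(\<integral>\<^sup>+\<omega>. ennreal (exp (u * X \<omega>)) \<partial>M)
      = (\<integral>\<^sup>+x. ennreal (normal_density 0 s x) * ennreal (exp (u * x)) \<partial>lborel)"
      by (rule distributed_nn_integral[OF normal(2), symmetric]) simp
    then show ?thesis
      using normal by (simp add: nn_integral_exp_normal)
  qed
  have "emeasure M {\<omega> \<in> space M. t < X \<omega>} = (\<integral>\<^sup>+\<omega>. indicator {\<omega> \<in> space M. t < X \<omega>} \<omega> \<partial>M)"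
    by simp
  also have "\<dots> \<le> (\<integral>\<^sup>+\<omega>. ennreal (exp (- u * t)) * ennreal (exp (u * X \<omega>)) \<partial>M)"
  proof (rule nn_integral_mono)
    fix \<omega>
    have "1 \<le> exp (- u * t) * exp (u * X \<omega>)" if "t < X \<omega>"
    proof -
      have "u * t \<le> u * X \<omega>" using that u by (intro mult_left_mono) auto
      then show ?thesis by (simp add: exp_add[symmetric])
    qed
    then show "indicator {\<omega> \<in> space M. t < X \<omega>} \<omega>
        \<le> ennreal (exp (- u * t)) * ennreal (exp (u * X \<omega>))"
      by (auto simp: indicator_def ennreal_mult'[symmetric])
  qed
  also have "\<dots> = ennreal (exp (- u * t) * exp (u\<^sup>2 * ?V / 2))"
    by (subst nn_integral_cmult) (simp_all add: mgf ennreal_mult'[symmetric])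
  finally have "measure M {\<omega> \<in> space M. t < X \<omega>} \<le> exp (- u * t) * exp (u\<^sup>2 * ?V / 2)"
    by (simp add: emeasure_eq_measure)
  also have "\<dots> \<le> exp (- u * t) * exp (u\<^sup>2 * v / 2)"
    using v by (intro mult_left_mono) (auto intro: mult_left_mono)
  also have "\<dots> = exp (u\<^sup>2 * v / 2 - u * t)"
    by (simp add: exp_add[symmetric])
  finally show ?thesis .
qed

section \<open>Joint laws determined by cosines\<close>

text \<open>The phases \<open>c = 0\<close> and \<open>c = - \<pi> / 2\<close> recover the real and imaginary parts of the characteristic
function. General finite measures are admitted because the induction for joint laws reweights the
underlying measures; dividing by the common total mass reduces this to probability measures.\<close>

lemma finite_measure_real_eqI_cos:
  fixes P Q :: "real measure"
  assumes "finite_measure P" "finite_measure Q"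
    and sets [measurable_cong, simp]: "sets P = sets borel" "sets Q = sets borel"
    and cos_eq: "\<And>t c. (\<integral>x. cos (t * x + c) \<partial>P) = (\<integral>x. cos (t * x + c) \<partial>Q)"
  shows "P = Q"
proof -
  interpret P: finite_measure P by fact
  interpret Q: finite_measure Q by fact
  have [simp]: "space P = UNIV" "space Q = UNIV"
    using sets_eq_imp_space_eq[OF sets(1)] sets_eq_imp_space_eq[OF sets(2)] by auto
  define m where "m = measure P UNIV"
  have m: "emeasure P UNIV = ennreal m" "emeasure Q UNIV = ennreal m"
    using cos_eq[of 0 0] by (simp_all add: m_def P.emeasure_eq_measure Q.emeasure_eq_measure)
  show ?thesis
  proof (cases "m > 0")
    case False
    then have "emeasure P UNIV = 0" "emeasure Q UNIV = 0" using m by (auto simp: ennreal_neg)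
    then have "emeasure P A = 0" "emeasure Q A = 0" for A
      using emeasure_mono[of A UNIV P] emeasure_mono[of A UNIV Q] by simp_all
    then show ?thesis by (intro measure_eqI) auto
  next
    case True
    define k where "k = ennreal (1 / m)"
    have km: "k * ennreal m = 1"
      using True by (simp add: k_def ennreal_mult'[symmetric])
    have kr: "k = ennreal (1 / m)" "0 \<le> 1 / m" using True by (auto simp: k_def)
    let ?P = "density P (\<lambda>_. k)" and ?Q = "density Q (\<lambda>_. k)"
    have "real_distribution ?P" "real_distribution ?Q"
      using m km by (auto simp: real_distribution_def real_distribution_axioms_def
          emeasure_density_const intro!: prob_spaceI)
    moreover have "char ?P = char ?Q"
    proof
      fix t
      have i: "complex_integrable P (\<lambda>x. iexp (t * x))" "complex_integrable Q (\<lambda>x. iexp (t * x))"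
        by (auto intro!: P.integrable_const_bound[where B=1] Q.integrable_const_bound[where B=1])
      have "(CLINT x|P. iexp (t * x)) = (CLINT x|Q. iexp (t * x))"
      proof (rule complex_eqI)
        show "Re (CLINT x|P. iexp (t * x)) = Re (CLINT x|Q. iexp (t * x))"
          using cos_eq[of t 0] integral_Re[OF i(1)] integral_Re[OF i(2)] by (simp add: Re_exp)
        show "Im (CLINT x|P. iexp (t * x)) = Im (CLINT x|Q. iexp (t * x))"
          using cos_eq[of t "- (pi / 2)"]
            integral_Im[OF i(1)] integral_Im[OF i(2)]
          by (simp add: Im_exp cos_diff)
      qed
      then show "char ?P t = char ?Q t"
        unfolding char_def kr(1) using kr(2)
        by (subst (1 2) integral_density) auto
    qed
    ultimately have PQ: "?P = ?Q" by (rule Levy_uniqueness)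
    show ?thesis
    proof (rule measure_eqI)
      fix A assume "A \<in> sets P"
      then have A: "A \<in> sets P" "A \<in> sets Q" by auto
      have "k * emeasure P A = k * emeasure Q A"
        using arg_cong[OF PQ, of "\<lambda>R. emeasure R A"] A by (simp add: emeasure_density_const)
      then have "ennreal m * (k * emeasure P A) = ennreal m * (k * emeasure Q A)" by simp
      then have "(k * ennreal m) * emeasure P A = (k * ennreal m) * emeasure Q A"
        by (simp only: mult_ac)
      then show "emeasure P A = emeasure Q A"
        by (simp add: km)
    qed simp
  qed
qed

lemma (in finite_measure) integrable_cos [simp, intro]:
  "Z \<in> borel_measurable M \<Longrightarrow> integrable M (\<lambda>\<omega>. cos (Z \<omega> :: real))"
  by (rule integrable_const_bound[where B=1]) auto

lemma finite_measure_density_bounded: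
  assumes "finite_measure M" "W \<in> borel_measurable M" "\<And>\<omega>. 0 \<le> W \<omega>" "\<And>\<omega>. W \<omega> \<le> (B::real)"
  shows "finite_measure (density M (\<lambda>\<omega>. ennreal (W \<omega>)))"
proof -
  interpret finite_measure M by fact
  have "integrable M W"
    using assms by (intro integrable_const_bound[where B=B]) auto
  then show ?thesis
    using assms by (intro finite_measureI) (auto simp: emeasure_density nn_integral_eq_integral)
qed

text \<open>The coordinates are treated one at a time. Fix a cosine \<open>cos (\<theta> + c)\<close> of the coordinates in \<open>I\<close> and
reweight both measures by the nonnegative bounded function \<open>1 + cos (\<theta> + c)\<close>. The product formula
for cosines turns the hypothesis into equality of all cosine integrals of the new coordinate \<open>j\<close>
under the reweighted measures, so the one-dimensional theorem applies. Read backwards, it says that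
after restriction to the event \<open>X j \<in> A j\<close> the remaining coordinates still satisfy the hypothesis.\<close>

lemma joint_law_eqI_cos:
  fixes X :: "'i \<Rightarrow> 'a \<Rightarrow> real" and Y :: "'i \<Rightarrow> 'b \<Rightarrow> real"
  assumes "finite I" "finite_measure M" "finite_measure N"
    and "\<And>i. i \<in> I \<Longrightarrow> X i \<in> borel_measurable M" "\<And>i. i \<in> I \<Longrightarrow> Y i \<in> borel_measurable N"
    and "\<And>t c. (\<integral>\<omega>. cos ((\<Sum>i\<in>I. t i * X i \<omega>) + c) \<partial>M) = (\<integral>\<omega>. cos ((\<Sum>i\<in>I. t i * Y i \<omega>) + c) \<partial>N)"
    and "\<And>i. i \<in> I \<Longrightarrow> A i \<in> sets borel"
  shows "measure M {\<omega> \<in> space M. \<forall>i\<in>I. X i \<omega> \<in> A i} = measure N {\<omega> \<in> space N. \<forall>i\<in>I. Y i \<omega> \<in> A i}"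
  using assms
proof (induction I arbitrary: M N rule: finite_induct)
  case empty
  from empty.prems(5)[of _ 0] show ?case by simp
next
  case (insert j I)
  interpret M: finite_measure M by fact
  interpret N: finite_measure N by fact
  have [measurable]: "X i \<in> borel_measurable M" "Y i \<in> borel_measurable N"
    if "i \<in> insert j I" for i
    using that insert.prems by auto
  have [measurable]: "X j \<in> borel_measurable M" "Y j \<in> borel_measurable N" "A j \<in> sets borel"
    using insert.prems by auto
  have [measurable]: "(\<lambda>\<omega>. \<Sum>i\<in>I. t i * X i \<omega>) \<in> borel_measurable M"
    "(\<lambda>\<omega>. \<Sum>i\<in>I. t i * Y i \<omega>) \<in> borel_measurable N" for t
    by measurable
  have cos_eq: "(\<integral>\<omega>. cos ((\<Sum>i\<in>I. t i * X i \<omega>) + s * X j \<omega> + c) \<partial>M)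
      = (\<integral>\<omega>. cos ((\<Sum>i\<in>I. t i * Y i \<omega>) + s * Y j \<omega> + c) \<partial>N)" for t s c
  proof -
    have "(\<Sum>i\<in>I. (t(j := s)) i * Z i) = (\<Sum>i\<in>I. t i * Z i)" for Z :: "'i \<Rightarrow> real"
      using insert.hyps by (intro sum.cong) auto
    then show ?thesis
      using insert.prems(5)[of "t(j := s)" c] insert.hyps by (simp add: add_ac)
  qed
  have weight: "(\<integral>\<omega>. (1 + cos ((\<Sum>i\<in>I. t i * X i \<omega>) + c)) * indicator (A j) (X j \<omega>) \<partial>M)
      = (\<integral>\<omega>. (1 + cos ((\<Sum>i\<in>I. t i * Y i \<omega>) + c)) * indicator (A j) (Y j \<omega>) \<partial>N)" for t c
  proof -
    define V where "V \<omega> = 1 + cos ((\<Sum>i\<in>I. t i * X i \<omega>) + c)" for \<omega>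
    define W where "W \<omega> = 1 + cos ((\<Sum>i\<in>I. t i * Y i \<omega>) + c)" for \<omega>
    have V: "0 \<le> V \<omega>" "V \<omega> \<le> 2" "0 \<le> W \<omega>'" "W \<omega>' \<le> 2" for \<omega> \<omega>'
      using cos_ge_minus_one[of "(\<Sum>i\<in>I. t i * X i \<omega>) + c"]
        cos_ge_minus_one[of "(\<Sum>i\<in>I. t i * Y i \<omega>') + c"]
      by (simp_all add: V_def W_def del: cos_ge_minus_one)
    have [measurable]: "V \<in> borel_measurable M" "W \<in> borel_measurable N"
      unfolding V_def W_def by measurable
    define M1 N1 where "M1 = density M (\<lambda>\<omega>. ennreal (V \<omega>))" and "N1 = density N (\<lambda>\<omega>. ennreal (W \<omega>))"
    interpret M1: finite_measure M1
      unfolding M1_def by (rule finite_measure_density_bounded[OF _ _ V(1) V(2)]) (use insert in auto)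
    interpret N1: finite_measure N1
      unfolding N1_def by (rule finite_measure_density_bounded[OF _ _ V(3) V(4)]) (use insert in auto)
    have [measurable]: "X j \<in> borel_measurable M1" "Y j \<in> borel_measurable N1"
      by (simp_all add: M1_def N1_def)
    have prod_cos: "(1 + cos a) * cos b = cos b + cos (a + b) / 2 + cos (a - b) / 2" for a b :: real
      by (simp add: cos_add cos_diff algebra_simps add_divide_distrib diff_divide_distrib)
    have "distr M1 borel (X j) = distr N1 borel (Y j)"
    proof (rule finite_measure_real_eqI_cos)
      fix s b
      have 1: "(\<integral>\<omega>. cos (s * X j \<omega> + b) \<partial>M) = (\<integral>\<omega>. cos (s * Y j \<omega> + b) \<partial>N)"
        using cos_eq[of "\<lambda>_. 0" s b] by simp
      have 2: "(\<integral>\<omega>. cos ((\<Sum>i\<in>I. t i * X i \<omega>) + c + (s * X j \<omega> + b)) \<partial>M)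
          = (\<integral>\<omega>. cos ((\<Sum>i\<in>I. t i * Y i \<omega>) + c + (s * Y j \<omega> + b)) \<partial>N)"
        using cos_eq[of t s "c + b"] by (simp add: add_ac)
      have 3: "(\<integral>\<omega>. cos ((\<Sum>i\<in>I. t i * X i \<omega>) + c - (s * X j \<omega> + b)) \<partial>M)
          = (\<integral>\<omega>. cos ((\<Sum>i\<in>I. t i * Y i \<omega>) + c - (s * Y j \<omega> + b)) \<partial>N)"
        using cos_eq[of t "- s" "c - b"] by (simp add: algebra_simps)
      have "(\<integral>x. cos (s * x + b) \<partial>distr M1 borel (X j)) = (\<integral>\<omega>. V \<omega> * cos (s * X j \<omega> + b) \<partial>M)"
        unfolding M1_def using V by (simp add: integral_distr integral_density)
      also have "\<dots> = (\<integral>\<omega>. W \<omega> * cos (s * Y j \<omega> + b) \<partial>N)"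
        unfolding V_def W_def prod_cos using 1 2 3 by simp
      also have "\<dots> = (\<integral>x. cos (s * x + b) \<partial>distr N1 borel (Y j))"
        unfolding N1_def using V by (simp add: integral_distr integral_density)
      finally show "(\<integral>x. cos (s * x + b) \<partial>distr M1 borel (X j))
          = (\<integral>x. cos (s * x + b) \<partial>distr N1 borel (Y j))" .
    qed (auto intro!: M1.finite_measure_distr N1.finite_measure_distr)
    moreover have "(\<integral>x. (indicator (A j) x :: real) \<partial>distr M1 borel (X j))
        = (\<integral>\<omega>. V \<omega> * indicator (A j) (X j \<omega>) \<partial>M)"
      using V(1) by (subst integral_distr) (simp_all add: M1_def integral_density)
    moreover have "(\<integral>x. (indicator (A j) x :: real) \<partial>distr N1 borel (Y j))
        = (\<integral>\<omega>. W \<omega> * indicator (A j) (Y j \<omega>) \<partial>N)"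
      using V(3) by (subst integral_distr) (simp_all add: N1_def integral_density)
    ultimately have "(\<integral>\<omega>. V \<omega> * indicator (A j) (X j \<omega>) \<partial>M)
        = (\<integral>\<omega>. W \<omega> * indicator (A j) (Y j \<omega>) \<partial>N)"
      by simp
    then show ?thesis by (simp add: V_def W_def)
  qed
  define U where "U \<omega> = (indicator (A j) (X j \<omega>) :: real)" for \<omega>
  define U' where "U' \<omega> = (indicator (A j) (Y j \<omega>) :: real)" for \<omega>
  have [measurable]: "U \<in> borel_measurable M" "U' \<in> borel_measurable N"
    unfolding U_def U'_def by measurable
  have U01: "0 \<le> U \<omega>" "U \<omega> \<le> 1" "0 \<le> U' \<omega>'" "U' \<omega>' \<le> 1" for \<omega> \<omega>'
    by (auto simp: U_def U'_def indicator_def)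
  have int: "integrable M U" "integrable N U'"
    "integrable M (\<lambda>\<omega>. U \<omega> * cos ((\<Sum>i\<in>I. t i * X i \<omega>) + c))"
    "integrable N (\<lambda>\<omega>. U' \<omega> * cos ((\<Sum>i\<in>I. t i * Y i \<omega>) + c))" for t c
    by (auto intro!: M.integrable_const_bound[where B=1] N.integrable_const_bound[where B=1]
        simp: U_def U'_def indicator_def)
  have mass: "integral\<^sup>L M U = integral\<^sup>L N U'"
    \<comment> \<open>At phase \<open>\<pi> / 2\<close> and frequency \<open>0\<close> the weight is constantly \<open>1\<close>.\<close>
    using weight[of "\<lambda>_. 0" "pi / 2"] by (simp add: U_def[symmetric] U'_def[symmetric])
  have restr: "(\<integral>\<omega>. U \<omega> * cos ((\<Sum>i\<in>I. t i * X i \<omega>) + c) \<partial>M)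
      = (\<integral>\<omega>. U' \<omega> * cos ((\<Sum>i\<in>I. t i * Y i \<omega>) + c) \<partial>N)" for t c
    using weight[of t c] mass int(1,2) int(3)[of t c] int(4)[of t c]
    by (simp add: U_def[symmetric] U'_def[symmetric] distrib_left mult.commute)
  \<comment> \<open>Restricting to the event that coordinate \<open>j\<close> lies in \<open>A j\<close>, written as a density.\<close>
  define M2 N2 where "M2 = density M (\<lambda>\<omega>. ennreal (U \<omega>))" and "N2 = density N (\<lambda>\<omega>. ennreal (U' \<omega>))"
  have fin: "finite_measure M2" "finite_measure N2"
    unfolding M2_def by (rule finite_measure_density_bounded[OF _ _ U01(1,2)]; use insert in auto)
      (unfold N2_def, rule finite_measure_density_bounded[OF _ _ U01(3,4)]; use insert in auto)
  have "measure M2 {\<omega> \<in> space M2. \<forall>i\<in>I. X i \<omega> \<in> A i} = measure N2 {\<omega> \<in> space N2. \<forall>i\<in>I. Y i \<omega> \<in> A i}"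
  proof (rule insert.IH[OF fin])
    show "(\<integral>\<omega>. cos ((\<Sum>i\<in>I. t i * X i \<omega>) + c) \<partial>M2) = (\<integral>\<omega>. cos ((\<Sum>i\<in>I. t i * Y i \<omega>) + c) \<partial>N2)" for t c
      unfolding M2_def N2_def using restr[of t c] U01 by (simp add: integral_density)
  qed (use insert.prems in \<open>auto simp: M2_def N2_def\<close>)
  moreover have "measure M2 {\<omega> \<in> space M2. \<forall>i\<in>I. X i \<omega> \<in> A i}
      = measure M {\<omega> \<in> space M. \<forall>i\<in>insert j I. X i \<omega> \<in> A i}"
  proof -
    have [measurable]: "{\<omega> \<in> space M. \<forall>i\<in>I. X i \<omega> \<in> A i} \<in> sets M"
      using insert.prems insert.hyps by measurable
    have "emeasure M2 {\<omega> \<in> space M. \<forall>i\<in>I. X i \<omega> \<in> A i}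
      = (\<integral>\<^sup>+\<omega>. ennreal (U \<omega>) * indicator {\<omega> \<in> space M. \<forall>i\<in>I. X i \<omega> \<in> A i} \<omega> \<partial>M)"
      unfolding M2_def by (rule emeasure_density) measurable
    also have "\<dots> = (\<integral>\<^sup>+\<omega>. indicator {\<omega> \<in> space M. \<forall>i\<in>insert j I. X i \<omega> \<in> A i} \<omega> \<partial>M)"
      by (intro nn_integral_cong) (auto simp: U_def split: split_indicator)
    also have "{\<omega> \<in> space M. \<forall>i\<in>insert j I. X i \<omega> \<in> A i}
        = {\<omega> \<in> space M. \<forall>i\<in>I. X i \<omega> \<in> A i} \<inter> (X j -` A j \<inter> space M)"
      by auto
    also have "(\<integral>\<^sup>+\<omega>. indicator \<dots> \<omega> \<partial>M) = emeasure M \<dots>"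
      by (intro nn_integral_indicator) measurable
    also have "{\<omega> \<in> space M. \<forall>i\<in>I. X i \<omega> \<in> A i} \<inter> (X j -` A j \<inter> space M)
        = {\<omega> \<in> space M. \<forall>i\<in>insert j I. X i \<omega> \<in> A i}"
      by auto
    finally show ?thesis by (simp add: measure_def M2_def)
  qed
  moreover have "measure N2 {\<omega> \<in> space N2. \<forall>i\<in>I. Y i \<omega> \<in> A i}
      = measure N {\<omega> \<in> space N. \<forall>i\<in>insert j I. Y i \<omega> \<in> A i}"
  proof -
    have [measurable]: "{\<omega> \<in> space N. \<forall>i\<in>I. Y i \<omega> \<in> A i} \<in> sets N"
      using insert.prems insert.hyps by measurable
    have "emeasure N2 {\<omega> \<in> space N. \<forall>i\<in>I. Y i \<omega> \<in> A i}
      = (\<integral>\<^sup>+\<omega>. ennreal (U' \<omega>) * indicator {\<omega> \<in> space N. \<forall>i\<in>I. Y i \<omega> \<in> A i} \<omega> \<partial>N)"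
      unfolding N2_def by (rule emeasure_density) measurable
    also have "\<dots> = (\<integral>\<^sup>+\<omega>. indicator {\<omega> \<in> space N. \<forall>i\<in>insert j I. Y i \<omega> \<in> A i} \<omega> \<partial>N)"
      by (intro nn_integral_cong) (auto simp: U'_def split: split_indicator)
    also have "{\<omega> \<in> space N. \<forall>i\<in>insert j I. Y i \<omega> \<in> A i}
        = {\<omega> \<in> space N. \<forall>i\<in>I. Y i \<omega> \<in> A i} \<inter> (Y j -` A j \<inter> space N)"
      by auto
    also have "(\<integral>\<^sup>+\<omega>. indicator \<dots> \<omega> \<partial>N) = emeasure N \<dots>"
      by (intro nn_integral_indicator) measurable
    also have "{\<omega> \<in> space N. \<forall>i\<in>I. Y i \<omega> \<in> A i} \<inter> (Y j -` A j \<inter> space N)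
        = {\<omega> \<in> space N. \<forall>i\<in>insert j I. Y i \<omega> \<in> A i}"
      by auto
    finally show ?thesis by (simp add: measure_def N2_def)
  qed
  ultimately show ?case by simp
qed

lemma distr_PiM_eqI_cos:
  fixes X :: "'i \<Rightarrow> 'a \<Rightarrow> real" and Y :: "'i \<Rightarrow> 'b \<Rightarrow> real"
  assumes I: "finite I" and MN: "finite_measure M" "finite_measure N"
    and X: "\<And>i. i \<in> I \<Longrightarrow> X i \<in> borel_measurable M" and Y: "\<And>i. i \<in> I \<Longrightarrow> Y i \<in> borel_measurable N"
    and cos: "\<And>t c. (\<integral>\<omega>. cos ((\<Sum>i\<in>I. t i * X i \<omega>) + c) \<partial>M) = (\<integral>\<omega>. cos ((\<Sum>i\<in>I. t i * Y i \<omega>) + c) \<partial>N)"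
  shows "distr M (Pi\<^sub>M I (\<lambda>_. borel)) (\<lambda>\<omega>. \<lambda>i\<in>I. X i \<omega>) = distr N (Pi\<^sub>M I (\<lambda>_. borel)) (\<lambda>\<omega>. \<lambda>i\<in>I. Y i \<omega>)"
proof -
  interpret M: finite_measure M by fact
  interpret N: finite_measure N by fact
  have [measurable]: "(\<lambda>\<omega>. \<lambda>i\<in>I. X i \<omega>) \<in> measurable M (Pi\<^sub>M I (\<lambda>_. borel))"
    "(\<lambda>\<omega>. \<lambda>i\<in>I. Y i \<omega>) \<in> measurable N (Pi\<^sub>M I (\<lambda>_. borel))"
    using X Y by (auto intro!: measurable_restrict)
  show ?thesis
  proof (rule measure_eqI_PiM_finite[OF I, where A="\<lambda>_. Pi\<^sub>E I (\<lambda>_. UNIV)"])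
    fix A :: "'i \<Rightarrow> real set" assume A: "\<And>i. i \<in> I \<Longrightarrow> A i \<in> sets borel"
    have PA: "Pi\<^sub>E I A \<in> sets (Pi\<^sub>M I (\<lambda>_. borel))"
      using A I by (intro sets_PiM_I_finite) auto
    have "(\<lambda>\<omega>. \<lambda>i\<in>I. X i \<omega>) -` Pi\<^sub>E I A \<inter> space M = {\<omega> \<in> space M. \<forall>i\<in>I. X i \<omega> \<in> A i}"
      "(\<lambda>\<omega>. \<lambda>i\<in>I. Y i \<omega>) -` Pi\<^sub>E I A \<inter> space N = {\<omega> \<in> space N. \<forall>i\<in>I. Y i \<omega> \<in> A i}"
      by (auto simp: PiE_iff)
    then show "emeasure (distr M (Pi\<^sub>M I (\<lambda>_. borel)) (\<lambda>\<omega>. \<lambda>i\<in>I. X i \<omega>)) (Pi\<^sub>E I A)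
        = emeasure (distr N (Pi\<^sub>M I (\<lambda>_. borel)) (\<lambda>\<omega>. \<lambda>i\<in>I. Y i \<omega>)) (Pi\<^sub>E I A)"
      using PA joint_law_eqI_cos[OF I MN X Y cos A]
      by (simp add: emeasure_distr M.emeasure_eq_measure N.emeasure_eq_measure)
  next
    show "range (\<lambda>_. Pi\<^sub>E I (\<lambda>_. UNIV)) \<subseteq> prod_algebra I (\<lambda>_. borel)"
      using I by (auto intro!: prod_algebraI_finite)
  next
    interpret D: finite_measure "distr M (Pi\<^sub>M I (\<lambda>_. borel :: real measure)) (\<lambda>\<omega>. \<lambda>i\<in>I. X i \<omega>)"
      by (rule M.finite_measure_distr) measurable
    show "emeasure (distr M (Pi\<^sub>M I (\<lambda>_. borel)) (\<lambda>\<omega>. \<lambda>i\<in>I. X i \<omega>)) (Pi\<^sub>E I (\<lambda>_. UNIV)) \<noteq> \<infinity>"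
      by (simp add: D.emeasure_eq_measure)
  qed (auto simp: space_PiM)
qed

section \<open>Gaussian processes and covariance\<close>

text \<open>The index map need not be injective: repeated indices are merged by adding their coefficients.
Families of box averages and differences of two pairings are handled in this way, without first
deciding whether the signed measures involved are distinct.\<close>

lemma centered_gaussian_process_reindex:
  assumes X: "centered_gaussian_process M I X" and p: "p ` K \<subseteq> I"
  shows "centered_gaussian_process M K (\<lambda>k. X (p k))"
  unfolding centered_gaussian_process_def
proof (intro allI impI)
  fix J and c :: "_ \<Rightarrow> real" assume J: "finite J \<and> J \<subseteq> K"
  have eq: "(\<Sum>j\<in>J. c j * X (p j) \<omega>) = (\<Sum>i\<in>p ` J. (\<Sum>j\<in>{j \<in> J. p j = i}. c j) * X i \<omega>)" for \<omega>
  proof -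
    have "(\<Sum>j\<in>J. c j * X (p j) \<omega>) = (\<Sum>i\<in>p ` J. \<Sum>j\<in>{j \<in> J. p j = i}. c j * X (p j) \<omega>)"
      using J by (intro sum.image_gen) simp
    also have "\<dots> = (\<Sum>i\<in>p ` J. \<Sum>j\<in>{j \<in> J. p j = i}. c j * X i \<omega>)"
      by (intro sum.cong refl) simp
    finally show ?thesis
      by (simp only: sum_distrib_right)
  qed
  have "finite (p ` J) \<and> p ` J \<subseteq> I"
    using J p by auto
  from X[unfolded centered_gaussian_process_def, rule_format, OF this] have "centered_gaussian M (\<lambda>\<omega>. \<Sum>i\<in>p ` J. (\<Sum>j\<in>{j \<in> J. p j = i}. c j) * X i \<omega>)" .
  then show "centered_gaussian M (\<lambda>\<omega>. \<Sum>j\<in>J. c j * X (p j) \<omega>)"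
    by (simp only: eq)
qed

lemma centered_gaussian_process_component:
  assumes X: "centered_gaussian_process M K X" and k: "k \<in> K"
  shows "centered_gaussian M (X k)"
proof -
  have "centered_gaussian M (\<lambda>\<omega>. \<Sum>i\<in>{k}. 1 * X i \<omega>)"
    using X[unfolded centered_gaussian_process_def, rule_format, of "{k}" "\<lambda>_. 1"] k by simp
  then show ?thesis by simp
qed

lemma second_moment_linear_combination:
  assumes M: "prob_space M" and X: "centered_gaussian_process M K X" and K: "finite K"
  shows "(\<integral>\<omega>. (\<Sum>k\<in>K. c k * X k \<omega>)\<^sup>2 \<partial>M)
    = (\<Sum>k\<in>K. \<Sum>l\<in>K. c k * c l * covariance M (X k) (X l))"
proof -
  note comp = centered_gaussian_process_component[OF X]
  have meas: "X k \<in> borel_measurable M" if "k \<in> K" for k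
    using comp[OF that] by (simp add: centered_gaussian_def)
  have int: "integrable M (\<lambda>\<omega>. X k \<omega> * X l \<omega>)" if "k \<in> K" "l \<in> K" for k l
  proof (rule Bochner_Integration.integrable_bound)
    show "integrable M (\<lambda>\<omega>. (X k \<omega>)\<^sup>2 + (X l \<omega>)\<^sup>2)"
      using centered_gaussian_integrable(1)[OF M comp] that by auto
    have "\<bar>x * y\<bar> \<le> x\<^sup>2 + y\<^sup>2" for x y :: real
    proof -
      have "2 * \<bar>x * y\<bar> \<le> x\<^sup>2 + y\<^sup>2"
        using sum_squares_bound[of "\<bar>x\<bar>" "\<bar>y\<bar>"] by (simp add: abs_mult)
      then show ?thesis by linarith
    qed
    then show "AE \<omega> in M. norm (X k \<omega> * X l \<omega>) \<le> norm ((X k \<omega>)\<^sup>2 + (X l \<omega>)\<^sup>2)"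
      by simp
    show "(\<lambda>\<omega>. X k \<omega> * X l \<omega>) \<in> borel_measurable M"
      using meas that by (intro borel_measurable_times)
  qed
  have cov: "covariance M (X k) (X l) = (\<integral>\<omega>. X k \<omega> * X l \<omega> \<partial>M)" if "k \<in> K" "l \<in> K" for k l
    using centered_gaussian_integrable(3)[OF M comp] that by (simp add: covariance_def)
  have "(\<integral>\<omega>. (\<Sum>k\<in>K. c k * X k \<omega>)\<^sup>2 \<partial>M)
      = (\<integral>\<omega>. (\<Sum>k\<in>K. \<Sum>l\<in>K. c k * c l * (X k \<omega> * X l \<omega>)) \<partial>M)"
    by (simp only: power2_eq_square sum_product mult_ac)
  also have "\<dots> = (\<Sum>k\<in>K. \<Sum>l\<in>K. c k * c l * (\<integral>\<omega>. X k \<omega> * X l \<omega> \<partial>M))"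
    using int by (simp add: Bochner_Integration.integral_sum cong: sum.cong)
  also have "\<dots> = (\<Sum>k\<in>K. \<Sum>l\<in>K. c k * c l * covariance M (X k) (X l))"
    by (intro sum.cong refl) (simp add: cov)
  finally show ?thesis .
qed

text \<open>Every linear combination is a centred Gaussian whose variance is a quadratic form in the covariance,
so corresponding combinations have the same law, in particular the same cosine integrals.\<close>

lemma gaussian_law_determined_by_covariance:
  fixes X :: "'i \<Rightarrow> 'a \<Rightarrow> real" and Y :: "'i \<Rightarrow> 'b \<Rightarrow> real"
  assumes M: "prob_space M" and X: "centered_gaussian_process M K X"
    and N: "prob_space N" and Y: "centered_gaussian_process N K Y"
    and K: "finite K"
    and cov: "\<And>k l. k \<in> K \<Longrightarrow> l \<in> K \<Longrightarrow> covariance M (X k) (X l) = covariance N (Y k) (Y l)"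
  shows "distr M (Pi\<^sub>M K (\<lambda>_. borel)) (\<lambda>\<omega>. \<lambda>k\<in>K. X k \<omega>) = distr N (Pi\<^sub>M K (\<lambda>_. borel)) (\<lambda>\<omega>. \<lambda>k\<in>K. Y k \<omega>)"
proof (rule distr_PiM_eqI_cos[OF K])
  show "finite_measure M" "finite_measure N"
    using M N by (simp_all add: prob_space.finite_measure)
  show meas: "X k \<in> borel_measurable M" "Y k \<in> borel_measurable N" if "k \<in> K" for k
    using centered_gaussian_process_component[OF X that] centered_gaussian_process_component[OF Y that]
    by (simp_all add: centered_gaussian_def)
  fix t :: "'i \<Rightarrow> real" and c :: real
  let ?X = "\<lambda>\<omega>. \<Sum>k\<in>K. t k * X k \<omega>" and ?Y = "\<lambda>\<omega>. \<Sum>k\<in>K. t k * Y k \<omega>"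
  have [measurable]: "?X \<in> borel_measurable M" "?Y \<in> borel_measurable N"
    using meas by (auto intro!: borel_measurable_sum borel_measurable_times)
  have "distr M borel ?X = distr N borel ?Y"
  proof (rule centered_gaussian_law_eq[OF M _ N])
    show "centered_gaussian M ?X" "centered_gaussian N ?Y"
      using X Y K unfolding centered_gaussian_process_def by auto
    show "(\<integral>\<omega>. (?X \<omega>)\<^sup>2 \<partial>M) = (\<integral>\<omega>. (?Y \<omega>)\<^sup>2 \<partial>N)"
      unfolding second_moment_linear_combination[OF M X K] second_moment_linear_combination[OF N Y K]
      by (intro sum.cong refl) (simp add: cov)
  qed
  then have "(\<integral>x. cos (x + c) \<partial>distr M borel ?X) = (\<integral>x. cos (x + c) \<partial>distr N borel ?Y)"
    by simp
  then show "(\<integral>\<omega>. cos (?X \<omega> + c) \<partial>M) = (\<integral>\<omega>. cos (?Y \<omega> + c) \<partial>N)"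
    by (simp add: integral_distr)
qed

section \<open>Logarithmic energy of measures of linear growth\<close>

text \<open>A layer-cake bound: near \<open>0\<close> the logarithm counts, up to one unit, the scales \<open>exp (- k)\<close> above
\<open>s\<close>, and it is infinite exactly when all scales are counted. For \<open>s > 1\<close> it is at most \<open>s\<close>.\<close>

lemma abs_ln_le_layers:
  fixes s :: real
  assumes s: "0 \<le> s" "s \<le> L"
  shows "(if s = 0 then \<infinity> else ennreal \<bar>ln s\<bar>)
    \<le> (\<Sum>k. if s \<le> exp (- real k) then 1 else 0) + ennreal L"
proof -
  let ?f = "\<lambda>k. if s \<le> exp (- real k) then 1 else (0::ennreal)"
  have part: "of_nat N \<le> suminf ?f" if "\<And>k. k < N \<Longrightarrow> s \<le> exp (- real k)" for N
  proof -
    have "of_nat N = sum ?f {..<N}"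
      using that by simp
    also have "\<dots> \<le> suminf ?f"
      by (rule sum_le_suminf) auto
    finally show ?thesis .
  qed
  consider "s = 0" | "0 < s" "s \<le> 1" | "1 < s" using s by linarith
  then show ?thesis
  proof cases
    case 1
    have "suminf ?f = \<infinity>"
    proof (rule ccontr)
      assume "suminf ?f \<noteq> \<infinity>"
      then obtain n where "suminf ?f < of_nat n"
        using ennreal_Ex_less_of_nat by (auto simp: top.not_eq_extremum infinity_ennreal_def)
      moreover have "of_nat n \<le> suminf ?f"
        by (rule part) (simp add: 1)
      ultimately show False by simp
    qed
    then show ?thesis by simp
  next
    case 2
    define N where "N = nat \<lceil>- ln s\<rceil>"
    have "s \<le> exp (- real k)" if "k < N" for k
    proof -
      have "real k < - ln s" using that by (simp add: N_def) linarith
      then have "exp (ln s) \<le> exp (- real k)" by simp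
      then show ?thesis using 2 by simp
    qed
    then have "of_nat N \<le> suminf ?f" by (rule part)
    moreover have "ennreal \<bar>ln s\<bar> \<le> of_nat N"
      using 2 by (auto simp: N_def ennreal_of_nat_eq_real_of_nat intro!: ennreal_leI)
    ultimately have "ennreal \<bar>ln s\<bar> \<le> suminf ?f" by (rule order.trans[rotated])
    then show ?thesis using 2 by (auto intro: add_increasing2)
  next
    case 3
    have "\<bar>ln s\<bar> \<le> L" using 3 s ln_le_minus_one[of s] by simp
    then have "ennreal \<bar>ln s\<bar> \<le> ennreal L" by (rule ennreal_leI)
    then show ?thesis using 3 by (auto intro: add_increasing)
  qed
qed

text \<open>By the layer-cake bound, the singular part of the potential of \<open>B\<close> at a point is a sum of masses of
balls of radii \<open>r * exp (- k)\<close>, and linear growth bounds it by a geometric series. All hypotheses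
are stated relative to the length scale \<open>r\<close> and the bound does not depend on \<open>r\<close>; this uniformity
is what makes the estimate useful for boxes of size \<open>\<epsilon>\<close>. The integrand is infinite on the
diagonal, so the product measure does not charge it.\<close>

lemma nn_integral_log_kernel_le:
  fixes A B :: "'a::euclidean_space measure"
  assumes A: "prob_space A" "sets A = sets borel" and B: "prob_space B" "sets B = sets borel"
    and pos: "0 < r" "0 \<le> C" "0 \<le> K"
    and growth: "\<And>p t. 0 < t \<Longrightarrow> emeasure B (cball p (r * t)) \<le> ennreal (C * t)"
    and supp: "AE x in A. dist a x \<le> K * r" "AE y in B. dist a y \<le> K * r"
  shows "(\<integral>\<^sup>+p. (if fst p = snd p then \<infinity> else ennreal \<bar>ln (dist (fst p) (snd p) / r)\<bar>) \<partial>(A \<Otimes>\<^sub>M B))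
    \<le> ennreal (C / (1 - exp (- 1)) + 2 * K)"
proof -
  interpret A: prob_space A by fact
  interpret B: prob_space B by fact
  note [measurable_cong] = A(2) B(2)
  have e: "0 < 1 - exp (- 1 :: real)" by simp
  let ?f = "\<lambda>p::'a \<times> 'a. if fst p = snd p then \<infinity> else ennreal \<bar>ln (dist (fst p) (snd p) / r)\<bar>"
  have f: "?f = (\<lambda>p. if dist (fst p) (snd p) = 0 then \<infinity> else ennreal \<bar>ln (dist (fst p) (snd p) / r)\<bar>)"
    by (auto simp: fun_eq_iff)
  have [measurable]: "?f \<in> borel_measurable (A \<Otimes>\<^sub>M B)"
    unfolding f by measurable
  have [measurable]: "cball x s \<in> sets B" for x s
    by (simp add: B(2))
  have inner: "(\<integral>\<^sup>+y. ?f (x, y) \<partial>B) \<le> ennreal (C / (1 - exp (- 1)) + 2 * K)"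
    if x: "dist a x \<le> K * r" for x
  proof -
    have "(\<integral>\<^sup>+y. ?f (x, y) \<partial>B)
        \<le> (\<integral>\<^sup>+y. (\<Sum>k. indicator (cball x (r * exp (- real k))) y) + ennreal (2 * K) \<partial>B)"
    proof (rule nn_integral_mono_AE)
      show "AE y in B. ?f (x, y) \<le> (\<Sum>k. indicator (cball x (r * exp (- real k))) y) + ennreal (2 * K)"
        using supp(2)
      proof eventually_elim
        fix y assume y: "dist a y \<le> K * r"
        have "dist x y \<le> 2 * K * r"
          using dist_triangle2[of x y a] x y by (simp add: dist_commute)
        then have "0 \<le> dist x y / r" "dist x y / r \<le> 2 * K"
          using pos by (auto simp: field_simps)
        note abs_ln_le_layers[OF this]
        moreover have "(if dist x y / r \<le> exp (- real k) then 1 else 0)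
            = (indicator (cball x (r * exp (- real k))) y :: ennreal)" for k
          using pos by (auto simp: field_simps)
        ultimately show "?f (x, y) \<le> (\<Sum>k. indicator (cball x (r * exp (- real k))) y) + ennreal (2 * K)"
          using pos by (auto split: if_splits)
      qed
    qed
    also have "\<dots> = (\<Sum>k. emeasure B (cball x (r * exp (- real k)))) + ennreal (2 * K)"
      by (subst nn_integral_add) (auto simp: nn_integral_suminf B.emeasure_space_1)
    also have "\<dots> \<le> (\<Sum>k. ennreal (C * exp (- 1) ^ k)) + ennreal (2 * K)"
    proof (intro add_right_mono suminf_le)
      show "emeasure B (cball x (r * exp (- real k))) \<le> ennreal (C * exp (- 1) ^ k)" for k
        using growth[of "exp (- real k)" x] by (simp add: exp_of_nat_mult[symmetric])
    qed auto
    also have "(\<Sum>k. ennreal (C * exp (- 1) ^ k)) = ennreal (\<Sum>k. C * exp (- 1) ^ k)"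
      using pos by (intro suminf_ennreal2) (auto intro!: summable_mult summable_geometric)
    also have "(\<Sum>k. C * exp (- 1) ^ k) = C / (1 - exp (- 1 :: real))"
      using suminf_geometric[of "exp (- 1) :: real"]
      by (subst suminf_mult) (auto intro!: summable_geometric)
    finally show ?thesis
      using pos e by (simp add: ennreal_plus[symmetric] del: ennreal_plus)
  qed
  have "integral\<^sup>N (A \<Otimes>\<^sub>M B) ?f = (\<integral>\<^sup>+x. \<integral>\<^sup>+y. ?f (x, y) \<partial>B \<partial>A)"
    by (rule B.nn_integral_fst[symmetric]) measurable
  also have "\<dots> \<le> (\<integral>\<^sup>+x. ennreal (C / (1 - exp (- 1)) + 2 * K) \<partial>A)"
    by (rule nn_integral_mono_AE) (use supp(1) inner in \<open>auto elim!: eventually_mono\<close>)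
  also have "\<dots> = ennreal (C / (1 - exp (- 1)) + 2 * K)"
    by (simp add: A.emeasure_space_1)
  finally show ?thesis .
qed

lemma finite_log_energyI:
  fixes A :: "'a::euclidean_space measure"
  assumes A: "prob_space A" "sets A = sets borel"
    and pos: "0 < r" "0 \<le> C" "0 \<le> K"
    and growth: "\<And>p t. 0 < t \<Longrightarrow> emeasure A (cball p (r * t)) \<le> ennreal (C * t)"
    and supp: "AE x in A. dist a x \<le> K * r"
  shows "finite_log_energy A"
proof -
  have "(\<integral>\<^sup>+p. (if fst p = snd p then \<infinity> else ennreal \<bar>ln (dist (fst p) (snd p) / 1)\<bar>) \<partial>(A \<Otimes>\<^sub>M A))
    \<le> ennreal (C / r / (1 - exp (- 1)) + 2 * (K * r))"
  proof (rule nn_integral_log_kernel_le[OF A A])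
    show "emeasure A (cball p (1 * t)) \<le> ennreal (C / r * t)" if "0 < t" for p t
      using growth[of "t / r" p] that pos by simp
  qed (use pos supp in auto)
  from le_less_trans[OF this[unfolded div_by_1] ennreal_less_top] show ?thesis
    by (simp add: finite_log_energy_def)
qed

text \<open>Rescaling lengths by \<open>r\<close> splits \<open>log (1 / r)\<close> off the kernel; the rest is integrable and bounded
by the preceding estimate.\<close>

lemma log_energy_near_log_scale:
  fixes A B :: "'a::euclidean_space measure"
  assumes A: "prob_space A" "sets A = sets borel" and B: "prob_space B" "sets B = sets borel"
    and pos: "0 < r" "0 \<le> C" "0 \<le> K"
    and growth: "\<And>p t. 0 < t \<Longrightarrow> emeasure B (cball p (r * t)) \<le> ennreal (C * t)"
    and supp: "AE x in A. dist a x \<le> K * r" "AE y in B. dist a y \<le> K * r"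
  shows "\<bar>log_energy A B - ln (1 / r)\<bar> \<le> C / (1 - exp (- 1)) + 2 * K"
proof -
  interpret A: prob_space A by fact
  interpret B: prob_space B by fact
  interpret pair_prob_space A B ..
  note [measurable_cong] = A(2) B(2)
  let ?R = "C / (1 - exp (- 1)) + 2 * K"
  have R: "0 \<le> ?R" using pos by simp
  let ?f = "\<lambda>p::'a \<times> 'a. if fst p = snd p then \<infinity> else ennreal \<bar>ln (dist (fst p) (snd p) / r)\<bar>"
  let ?g = "\<lambda>p::'a \<times> 'a. ln (dist (fst p) (snd p) / r)"
  have f: "?f = (\<lambda>p. if dist (fst p) (snd p) = 0 then \<infinity> else ennreal \<bar>ln (dist (fst p) (snd p) / r)\<bar>)"
    by (auto simp: fun_eq_iff)
  have [measurable]: "?f \<in> borel_measurable (A \<Otimes>\<^sub>M B)"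
    unfolding f by measurable
  have bound: "(\<integral>\<^sup>+p. ?f p \<partial>(A \<Otimes>\<^sub>M B)) \<le> ennreal ?R"
    by (rule nn_integral_log_kernel_le[OF A B pos growth supp])
  have "AE p in A \<Otimes>\<^sub>M B. ?f p \<noteq> \<infinity>"
    by (rule nn_integral_PInf_AE) (use bound in \<open>auto simp: top_unique\<close>)
  then have off_diag: "AE p in A \<Otimes>\<^sub>M B. fst p \<noteq> snd p"
    by eventually_elim auto
  have gf: "(\<integral>\<^sup>+p. ennreal (norm (?g p)) \<partial>(A \<Otimes>\<^sub>M B)) \<le> ennreal ?R"
    by (rule order.trans[OF nn_integral_mono_AE bound]) (use off_diag in auto)
  have int: "integrable (A \<Otimes>\<^sub>M B) ?g"
    by (rule integrableI_bounded) (use gf in \<open>auto intro: le_less_trans\<close>)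
  have "log_energy A B = (\<integral>p. ln (1 / r) - ?g p \<partial>(A \<Otimes>\<^sub>M B))"
    unfolding log_energy_def
  proof (rule integral_cong_AE)
    show "AE p in A \<Otimes>\<^sub>M B. ln (1 / dist (fst p) (snd p)) = ln (1 / r) - ?g p"
      using off_diag
    proof eventually_elim
      fix p :: "'a \<times> 'a" assume "fst p \<noteq> snd p"
      then show "ln (1 / dist (fst p) (snd p)) = ln (1 / r) - ?g p"
        using pos by (simp add: ln_div)
    qed
  qed measurable
  also have "\<dots> = ln (1 / r) - (\<integral>p. ?g p \<partial>(A \<Otimes>\<^sub>M B))"
    using int by (simp add: P.prob_space)
  finally have "\<bar>log_energy A B - ln (1 / r)\<bar> = norm (\<integral>p. ?g p \<partial>(A \<Otimes>\<^sub>M B))"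
    by simp
  moreover have "ennreal (norm (\<integral>p. ?g p \<partial>(A \<Otimes>\<^sub>M B))) \<le> ennreal ?R"
    by (rule order.trans[OF integral_norm_bound_ennreal[OF int] gf])
  ultimately show ?thesis using R by (simp del: real_norm_def)
qed

lemma log_energy_commute:
  assumes A: "prob_space A" "sets A = sets borel" and B: "prob_space B" "sets B = sets borel"
  shows "log_energy A B = log_energy B (A :: 'a::euclidean_space measure)"
proof -
  interpret A: prob_space A by fact
  interpret B: prob_space B by fact
  interpret pair_sigma_finite A B ..
  note [measurable_cong] = A(2) B(2)
  have "log_energy B A = (\<integral>(x, y). ln (1 / dist x y) \<partial>(B \<Otimes>\<^sub>M A))"
    unfolding log_energy_def by (simp add: case_prod_unfold)
  also have "\<dots> = (\<integral>(x, y). ln (1 / dist y x) \<partial>(B \<Otimes>\<^sub>M A))"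
    by (simp add: dist_commute)
  also have "\<dots> = log_energy A B"
    unfolding log_energy_def
    by (subst integral_product_swap[symmetric]) (auto simp: case_prod_unfold)
  finally show ?thesis by simp
qed

lemma log_energy_distr_isometry:
  fixes \<iota> :: "'a::euclidean_space \<Rightarrow> 'b::euclidean_space"
  assumes A: "finite_measure A" "sets A = sets borel" and B: "finite_measure B" "sets B = sets borel"
    and iso: "\<And>x y. dist (\<iota> x) (\<iota> y) = dist x y" and \<iota> [measurable]: "\<iota> \<in> borel_measurable borel"
  shows "log_energy (distr A borel \<iota>) (distr B borel \<iota>) = log_energy A B"
proof -
  note [measurable_cong] = A(2) B(2)
  interpret B: finite_measure "distr B borel \<iota>"
    using B by (intro finite_measure.finite_measure_distr) measurable
  have "distr A borel \<iota> \<Otimes>\<^sub>M distr B borel \<iota> = distr (A \<Otimes>\<^sub>M B) (borel \<Otimes>\<^sub>M borel) (\<lambda>(x, y). (\<iota> x, \<iota> y))"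
    by (rule pair_measure_distr) (measurable, unfold_locales)
  then show ?thesis
    unfolding log_energy_def by (simp add: integral_distr case_prod_unfold iso)
qed

lemma finite_log_energy_distr_isometry:
  fixes \<iota> :: "'a::euclidean_space \<Rightarrow> 'b::euclidean_space"
  assumes A: "finite_measure A" "sets A = sets borel" and fin: "finite_log_energy A"
    and iso: "\<And>x y. dist (\<iota> x) (\<iota> y) = dist x y" and \<iota> [measurable]: "\<iota> \<in> borel_measurable borel"
  shows "finite_log_energy (distr A borel \<iota>)"
proof -
  note [measurable_cong] = A(2)
  interpret A': finite_measure "distr A borel \<iota>"
    using A by (intro finite_measure.finite_measure_distr) measurable
  have inj: "\<iota> x = \<iota> y \<longleftrightarrow> x = y" for x y
    using iso[of x y] by (metis dist_eq_0_iff)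
  have f: "(\<lambda>p::'b \<times> 'b. if fst p = snd p then \<infinity> else ennreal \<bar>ln (dist (fst p) (snd p))\<bar>)
    = (\<lambda>p. if dist (fst p) (snd p) = 0 then \<infinity> else ennreal \<bar>ln (dist (fst p) (snd p))\<bar>)"
    by (auto simp: fun_eq_iff)
  have [measurable]: "(\<lambda>p::'b \<times> 'b. if fst p = snd p then \<infinity> else ennreal \<bar>ln (dist (fst p) (snd p))\<bar>)
      \<in> borel_measurable (borel \<Otimes>\<^sub>M borel)"
    unfolding f by measurable
  have "distr A borel \<iota> \<Otimes>\<^sub>M distr A borel \<iota> = distr (A \<Otimes>\<^sub>M A) (borel \<Otimes>\<^sub>M borel) (\<lambda>(x, y). (\<iota> x, \<iota> y))"
    by (rule pair_measure_distr) (measurable, unfold_locales)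
  then show ?thesis
    using fin unfolding finite_log_energy_def
    by (simp add: nn_integral_distr case_prod_unfold iso inj cong: if_cong)
qed

section \<open>Boxes and the unit sphere\<close>

definition box_measure :: "real \<Rightarrow> real^'n \<Rightarrow> (real^'n) measure" where
  "box_measure \<epsilon> x = uniform_measure lborel (cbox (x - (\<chi> i. \<epsilon>)) (x + (\<chi> i. \<epsilon>)))"

lemma mem_cube_iff: "y \<in> cbox (x - (\<chi> i. s)) (x + (\<chi> i. s)) \<longleftrightarrow> (\<forall>i. \<bar>y $ i - x $ i\<bar> \<le> s)"
  for x :: "real^'n"
  by (auto simp: mem_box_cart abs_le_iff algebra_simps)

lemma emeasure_lborel_cube:
  fixes x :: "real^'n"
  assumes "0 \<le> s"
  shows "emeasure lborel (cbox (x - (\<chi> i. s)) (x + (\<chi> i. s))) = ennreal ((2 * s) ^ CARD('n))"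
proof -
  have ne: "cbox (x - (\<chi> i. s)) (x + (\<chi> i. s)) \<noteq> {}"
    using assms mem_cube_iff[of x x s] by auto
  have "measure lborel (cbox (x - (\<chi> i. s)) (x + (\<chi> i. s))) = (2 * s) ^ CARD('n)"
    by (simp add: content_cbox_cart[OF ne])
  then show ?thesis
    by (metis emeasure_eq_ennreal_measure emeasure_lborel_cbox_finite less_irrefl infinity_ennreal_def)
qed

lemma sets_box_measure [simp, measurable_cong]: "sets (box_measure \<epsilon> x) = sets borel"
  by (simp add: box_measure_def)

lemma space_box_measure [simp]: "space (box_measure \<epsilon> x) = UNIV"
  by (simp add: box_measure_def)

lemma prob_space_box_measure:
  fixes x :: "real^'n"
  assumes "0 < \<epsilon>"
  shows "prob_space (box_measure \<epsilon> x)"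
  unfolding box_measure_def
  by (rule prob_space_uniform_measure) (use assms in \<open>auto simp: emeasure_lborel_cube\<close>)

text \<open>The intersection with a cube of half-side \<open>\<epsilon> * t\<close> has relative volume at most \<open>t\<^sup>n\<close>, which is at most
\<open>t\<close> when \<open>t \<le> 1\<close>. The bound is stated for cubes rather than balls because, for the flat box, the
preimage of a ball of the higher-dimensional space lies in a cube around the projected centre.\<close>

lemma box_measure_cube_le:
  fixes x q :: "real^'n"
  assumes "0 < \<epsilon>" "0 < t"
  shows "emeasure (box_measure \<epsilon> x) {y. \<forall>i. \<bar>y $ i - q $ i\<bar> \<le> \<epsilon> * t} \<le> ennreal t"
proof -
  interpret prob_space "box_measure \<epsilon> x" by (rule prob_space_box_measure[OF assms(1)])
  let ?B = "cbox (x - (\<chi> i. \<epsilon>)) (x + (\<chi> i. \<epsilon>))" and ?C = "cbox (q - (\<chi> i. \<epsilon> * t)) (q + (\<chi> i. \<epsilon> * t))"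
  have C: "{y. \<forall>i. \<bar>y $ i - q $ i\<bar> \<le> \<epsilon> * t} = ?C"
    by (auto simp: mem_cube_iff)
  show ?thesis
  proof (cases "t \<le> 1")
    case False
    have "emeasure (box_measure \<epsilon> x) ?C \<le> 1" by (rule emeasure_le_1)
    also have "1 \<le> ennreal t" using False by simp
    finally show ?thesis unfolding C .
  next
    case True
    have "emeasure (box_measure \<epsilon> x) ?C = emeasure lborel (?B \<inter> ?C) / emeasure lborel ?B"
      unfolding box_measure_def by (rule emeasure_uniform_measure) auto
    also have "\<dots> \<le> emeasure lborel ?C / emeasure lborel ?B"
      by (intro divide_right_mono_ennreal emeasure_mono) auto
    also have "\<dots> = ennreal ((2 * (\<epsilon> * t)) ^ CARD('n) / (2 * \<epsilon>) ^ CARD('n))"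
      using assms by (simp add: emeasure_lborel_cube divide_ennreal)
    also have "(2 * (\<epsilon> * t)) ^ CARD('n) / (2 * \<epsilon>) ^ CARD('n) = t ^ CARD('n)"
      using assms by (simp add: power_mult_distrib)
    also have "ennreal (t ^ CARD('n)) \<le> ennreal t"
      using power_decreasing[of 1 "CARD('n)" t] assms True by (intro ennreal_leI) auto
    finally show ?thesis unfolding C .
  qed
qed

lemma box_measure_growth:
  fixes x :: "real^'n"
  assumes "0 < \<epsilon>" "0 < t"
  shows "emeasure (box_measure \<epsilon> x) (cball p (\<epsilon> * t)) \<le> ennreal t"
proof -
  have "\<bar>y $ i - p $ i\<bar> \<le> \<epsilon> * t" if "y \<in> cball p (\<epsilon> * t)" for y i
    using component_le_norm_cart[of "y - p" i] that by (simp add: dist_norm norm_minus_commute)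
  moreover have "{y. \<forall>i. \<bar>y $ i - p $ i\<bar> \<le> \<epsilon> * t} \<in> sets borel"
    by measurable
  ultimately have "emeasure (box_measure \<epsilon> x) (cball p (\<epsilon> * t))
      \<le> emeasure (box_measure \<epsilon> x) {y. \<forall>i. \<bar>y $ i - p $ i\<bar> \<le> \<epsilon> * t}"
    by (intro emeasure_mono) auto
  also have "\<dots> \<le> ennreal t" by (rule box_measure_cube_le[OF assms])
  finally show ?thesis .
qed

lemma box_measure_support:
  fixes x :: "real^'n"
  assumes "0 < \<epsilon>"
  shows "AE y in box_measure \<epsilon> x. dist x y \<le> real CARD('n) * \<epsilon>"
  unfolding box_measure_def
proof (rule AE_uniform_measureI)
  have "dist x y \<le> real CARD('n) * \<epsilon>" if "y \<in> cbox (x - (\<chi> i. \<epsilon>)) (x + (\<chi> i. \<epsilon>))" for y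
  proof -
    have "dist x y \<le> (\<Sum>i\<in>UNIV. \<bar>(y - x) $ i\<bar>)"
      using norm_le_l1_cart[of "y - x"] by (simp add: dist_norm norm_minus_commute)
    also have "\<dots> \<le> (\<Sum>i\<in>(UNIV::'n set). \<epsilon>)"
      using that by (intro sum_mono) (simp add: mem_cube_iff)
    finally show ?thesis by simp
  qed
  then show "AE y in lborel. y \<in> cbox (x - (\<chi> i. \<epsilon>)) (x + (\<chi> i. \<epsilon>)) \<longrightarrow> dist x y \<le> real CARD('n) * \<epsilon>"
    by simp
qed simp

lemma finite_log_energy_box_measure:
  fixes x :: "real^'n"
  assumes "0 < \<epsilon>"
  shows "finite_log_energy (box_measure \<epsilon> x)"
  by (rule finite_log_energyI[where r=\<epsilon> and C=1, OF prob_space_box_measure _ _ _ _ _ box_measure_support])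
    (use assms box_measure_growth in auto)

lemma sets_sphere_unif [simp, measurable_cong]: "sets sphere_unif = sets borel"
  by (simp add: sphere_unif_def)

lemma measurable_normalize [measurable]:
  "(\<lambda>x::'a::euclidean_space. x /\<^sub>R norm x) \<in> borel_measurable borel"
  by measurable

lemma prob_space_uniform_ball:
  "prob_space (uniform_measure lborel (ball (0::'a::euclidean_space) 1))"
proof (rule prob_space_uniform_measure)
  have "unit_ball_vol (real DIM('a)) > 0" by simp
  then show "emeasure lborel (ball (0::'a) 1) \<noteq> 0" "emeasure lborel (ball (0::'a) 1) \<noteq> \<infinity>"
    by (simp_all add: emeasure_ball del: unit_ball_vol_pos)
qed

lemma prob_space_sphere_unif: "prob_space (sphere_unif :: 'a::euclidean_space measure)"
  unfolding sphere_unif_def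
  by (rule prob_space.prob_space_distr[OF prob_space_uniform_ball]) measurable

lemma sphere_unif_support: "AE y in sphere_unif :: 'a::euclidean_space measure. dist 0 y \<le> 1"
proof -
  have "norm (x /\<^sub>R norm x) \<le> 1" for x :: 'a
    by (cases "x = 0") auto
  then show ?thesis
    unfolding sphere_unif_def by (subst AE_distr_iff) (simp_all del: norm_scaleR)
qed

text \<open>The points of the unit ball whose direction is within \<open>t\<close> of \<open>p\<close> lie within \<open>t\<close> of the segment from
\<open>0\<close> to \<open>p\<close>. Along this segment about \<open>1 / t\<close> centres suffice for a covering by balls of radius
\<open>3 * t\<close>: the offset along the segment costs at most \<open>2 * t\<close>, since such a \<open>p\<close> has norm at most
\<open>2\<close>.\<close>

lemma sphere_cap_cone_subset:
  fixes p :: "'a::euclidean_space"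
  assumes t: "0 < t" "t < 1" and x: "x \<in> ball 0 1" "dist p (x /\<^sub>R norm x) \<le> t"
  defines "N \<equiv> nat \<lceil>1 / t\<rceil>"
  shows "x \<in> (\<Union>k<N. cball ((real k / real N) *\<^sub>R p) (3 * t))"
proof -
  define s where "s = norm x"
  have s: "0 \<le> s" "s < 1" using x by (simp_all add: s_def)
  have N: "1 / t \<le> real N" "0 < N"
    using t by (auto simp: N_def)
  then have N': "1 / real N \<le> t" using t by (simp add: field_simps)
  have xs: "x = s *\<^sub>R (x /\<^sub>R norm x)"
    by (cases "x = 0") (simp_all add: s_def)
  have "dist (s *\<^sub>R p) x = s * dist p (x /\<^sub>R norm x)"
    by (subst xs) (use s in \<open>simp add: dist_norm scaleR_diff_right[symmetric] del: scaleR_scaleR\<close>)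
  also have "\<dots> \<le> 1 * t" using s x by (intro mult_mono) auto
  finally have 1: "dist (s *\<^sub>R p) x \<le> t" by simp
  define k where "k = nat \<lfloor>s * real N\<rfloor>"
  have sN: "0 \<le> s * real N" "s * real N < real N"
    using s N by auto
  then have k: "real k \<le> s * real N" "s * real N < real k + 1" "k < N"
    by (auto simp: k_def) linarith+
  have np: "norm p \<le> 2"
  proof -
    have "norm p \<le> dist p (x /\<^sub>R norm x) + norm (x /\<^sub>R norm x)"
      using norm_triangle_sub[of p "x /\<^sub>R norm x"] by (simp add: dist_norm)
    also have "norm (x /\<^sub>R norm x) \<le> 1"
      by (cases "x = 0") auto
    finally show ?thesis using x t by linarith
  qed
  have "dist ((real k / real N) *\<^sub>R p) (s *\<^sub>R p) = \<bar>real k / real N - s\<bar> * norm p"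
    by (simp add: dist_norm scaleR_diff_left[symmetric])
  also have "\<dots> \<le> t * 2"
  proof (intro mult_mono np)
    have "real k / real N \<le> s" "s \<le> (real k + 1) / real N"
      using k N by (simp_all add: pos_divide_le_eq pos_le_divide_eq)
    then have "\<bar>real k / real N - s\<bar> \<le> 1 / real N"
      by (simp add: add_divide_distrib abs_le_iff)
    then show "\<bar>real k / real N - s\<bar> \<le> t" using N' by linarith
  qed (use t in auto)
  finally have "dist ((real k / real N) *\<^sub>R p) x \<le> 3 * t"
    using 1 dist_triangle[of "(real k / real N) *\<^sub>R p" x "s *\<^sub>R p"] by linarith
  then show ?thesis using k(3) by auto
qed

text \<open>Covering the cone over a cap by about \<open>1 / t\<close> balls of volume of order \<open>t\<^sup>d\<close> bounds its mass by a
multiple of \<open>t\<^sup>d\<^sup>-\<^sup>1\<close>. This is where the dimension must be at least \<open>2\<close>: on the line the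
unit sphere consists of two atoms.\<close>

lemma sphere_unif_growth:
  fixes p :: "'a::euclidean_space"
  assumes d: "2 \<le> DIM('a)" and t: "0 < t"
  shows "emeasure sphere_unif (cball p t) \<le> ennreal (2 * 3 ^ DIM('a) * t)"
proof (cases "t < 1")
  case False
  interpret prob_space "sphere_unif :: 'a measure" by (rule prob_space_sphere_unif)
  have "emeasure sphere_unif (cball p t) \<le> 1" by (rule emeasure_le_1)
  also have "1 \<le> ennreal (2 * 3 ^ DIM('a) * t)"
  proof -
    have "1 \<le> 2 * (3::real) ^ DIM('a)"
      using one_le_power[of "3::real" "DIM('a)"] by linarith
    then have "1 * 1 \<le> (2 * 3 ^ DIM('a)) * t"
      using False by (intro mult_mono) auto
    then show ?thesis by simp
  qed
  finally show ?thesis .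
next
  case True
  define N where "N = nat \<lceil>1 / t\<rceil>"
  let ?v = "unit_ball_vol (real DIM('a))"
  have v: "0 < ?v" by simp
  then have v0: "?v \<noteq> 0" by linarith
  let ?S = "(\<lambda>x. x /\<^sub>R norm x) -` cball p t \<inter> UNIV :: 'a set"
  have S: "?S \<in> sets borel"
    using measurable_sets[OF measurable_normalize, of "cball p t"] by simp
  have "real N \<le> 1 / t + 1" using t by (simp add: N_def)
  also have "\<dots> \<le> 2 / t" using t True by (simp add: field_simps)
  finally have N: "real N \<le> 2 / t" .
  have "emeasure sphere_unif (cball p t)
      = emeasure (uniform_measure lborel (ball 0 1)) ?S"
    unfolding sphere_unif_def by (subst emeasure_distr) auto
  also have "\<dots> = emeasure lborel (ball 0 1 \<inter> ?S) / emeasure lborel (ball 0 1 :: 'a set)"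
    using S by (intro emeasure_uniform_measure) auto
  also have "\<dots> \<le> ennreal (real N * (?v * (3 * t) ^ DIM('a))) / emeasure lborel (ball 0 1 :: 'a set)"
  proof (rule divide_right_mono_ennreal)
    have "emeasure lborel (ball 0 1 \<inter> ?S)
        \<le> emeasure lborel (\<Union>k<N. cball ((real k / real N) *\<^sub>R p) (3 * t))"
      using sphere_cap_cone_subset[OF t True, of _ p] by (intro emeasure_mono) (auto simp: N_def)
    also have "\<dots> \<le> (\<Sum>k<N. emeasure lborel (cball ((real k / real N) *\<^sub>R p) (3 * t)))"
      by (intro emeasure_subadditive_finite) auto
    also have "\<dots> = ennreal (real N * (?v * (3 * t) ^ DIM('a)))"
      using t v by (simp add: emeasure_cball ennreal_mult ennreal_of_nat_eq_real_of_nat)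
    finally show "emeasure lborel (ball 0 1 \<inter> ?S) \<le> ennreal (real N * (?v * (3 * t) ^ DIM('a)))" .
  qed
  also have "\<dots> = ennreal (real N * (3 * t) ^ DIM('a))"
    using t v v0 by (simp add: emeasure_ball divide_ennreal)
  also have "\<dots> \<le> ennreal (2 * 3 ^ DIM('a) * t)"
  proof (rule ennreal_leI)
    have "t ^ DIM('a) \<le> t ^ 2" using d t True by (intro power_decreasing) auto
    then have "real N * (3 ^ DIM('a) * t ^ DIM('a)) \<le> 2 / t * (3 ^ DIM('a) * t ^ 2)"
      using N t by (intro mult_mono) auto
    then show "real N * (3 * t) ^ DIM('a) \<le> 2 * 3 ^ DIM('a) * t"
      using t by (simp add: power_mult_distrib power2_eq_square)
  qed
  finally show ?thesis .
qed

lemma finite_log_energy_sphere_unif: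
  assumes "2 \<le> DIM('a::euclidean_space)"
  shows "finite_log_energy (sphere_unif :: 'a measure)"
  by (rule finite_log_energyI[OF prob_space_sphere_unif, where r=1 and C="2 * 3 ^ DIM('a)" and K=1 and a=0])
    (use sphere_unif_growth[OF assms] sphere_unif_support in auto)

section \<open>Coordinate embeddings\<close>

definition coord_embed :: "('n \<Rightarrow> 'm) \<Rightarrow> real^'n \<Rightarrow> real^'m" where
  "coord_embed e x = (\<chi> j. if j \<in> range e then x $ inv e j else 0)"

lemma coord_embed_nth [simp]: "inj e \<Longrightarrow> coord_embed e x $ e i = x $ i"
  by (simp add: coord_embed_def)

lemma coord_embed_outside: "j \<notin> range e \<Longrightarrow> coord_embed e x $ j = 0"
  by (simp add: coord_embed_def)

lemma dist_coord_embed: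
  assumes "inj e"
  shows "dist (coord_embed e x) (coord_embed e y) = dist x y"
proof -
  have "(\<Sum>j\<in>UNIV. (dist (coord_embed e x $ j) (coord_embed e y $ j))\<^sup>2)
      = (\<Sum>j\<in>range e. (dist (coord_embed e x $ j) (coord_embed e y $ j))\<^sup>2)"
    by (rule sum.mono_neutral_right) (auto simp: coord_embed_outside)
  also have "\<dots> = (\<Sum>i\<in>UNIV. (dist (x $ i) (y $ i))\<^sup>2)"
    using assms by (simp add: sum.reindex)
  finally show ?thesis
    by (simp add: dist_vec_def L2_set_def)
qed

lemma measurable_coord_embed: "inj e \<Longrightarrow> coord_embed e \<in> borel_measurable borel"
  by (rule borel_measurable_continuous_onI) (auto simp: continuous_on_iff dist_coord_embed)

section \<open>Lattice crossings with general weights\<close>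

text \<open>The crossing distance as a function of the field values on the lattice alone. Separating it from the
probability space allows the same functional to be evaluated on two realisations of the field, and
its law to be read off from the joint law of finitely many values.\<close>

definition weighted_set_dist ::
  "real \<Rightarrow> real \<Rightarrow> (real^'n \<Rightarrow> real) \<Rightarrow> (real^'n) set \<Rightarrow> (real^'n) set \<Rightarrow> (real^'n) set \<Rightarrow> ereal" where
  "weighted_set_dist \<epsilon> \<xi> g U V A =
     (INF z\<in>U. INF w\<in>V. INF P\<in>Collect (lattice_path \<epsilon> A z w). ereal (\<Sum>x\<leftarrow>P. \<epsilon> * exp (\<xi> * g x)))"

lemma lfpp_set_dist_eq_weighted:
  "lfpp_set_dist h \<epsilon> \<xi> \<omega> U V A = weighted_set_dist \<epsilon> \<xi> (\<lambda>x. box_average h \<epsilon> x \<omega>) U V A"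
  by (simp add: lfpp_set_dist_def lfpp_dist_def lfpp_length_def weighted_set_dist_def)

lemma weighted_set_dist_cong:
  assumes "\<And>x. x \<in> A \<Longrightarrow> g x = g' x"
  shows "weighted_set_dist \<epsilon> \<xi> g U V A = weighted_set_dist \<epsilon> \<xi> g' U V A"
proof -
  have "(\<Sum>x\<leftarrow>P. \<epsilon> * exp (\<xi> * g x)) = (\<Sum>x\<leftarrow>P. \<epsilon> * exp (\<xi> * g' x))"
    if "P \<in> Collect (lattice_path \<epsilon> A z w)" for P z w
    using that assms by (intro arg_cong[where f=sum_list] map_cong) (auto simp: lattice_path_def)
  then show ?thesis
    unfolding weighted_set_dist_def by (intro INF_cong) auto
qed

text \<open>Only countably many lattice paths stay in a countable set, since paths are finite lists.\<close>

lemma borel_measurable_weighted_set_dist: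
  assumes A: "countable A" "countable U" "countable V"
    and g: "\<And>x. x \<in> A \<Longrightarrow> (\<lambda>\<omega>. g \<omega> x) \<in> borel_measurable M"
  shows "(\<lambda>\<omega>. weighted_set_dist \<epsilon> \<xi> (g \<omega>) U V A) \<in> borel_measurable M"
proof -
  have path: "(\<lambda>\<omega>. \<Sum>x\<leftarrow>P. \<epsilon> * exp (\<xi> * g \<omega> x)) \<in> borel_measurable M" if "set P \<subseteq> A" for P
    using that
  proof (induction P)
    case (Cons x P)
    have [measurable]: "(\<lambda>\<omega>. g \<omega> x) \<in> borel_measurable M"
      using g Cons.prems by simp
    have [measurable]: "(\<lambda>\<omega>. \<Sum>x\<leftarrow>P. \<epsilon> * exp (\<xi> * g \<omega> x)) \<in> borel_measurable M"
      using Cons by simp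
    show ?case by simp
  qed simp
  have count: "countable (Collect (lattice_path \<epsilon> A z w))" for z w
    by (rule countable_subset[OF _ countable_lists[OF A(1)]]) (auto simp: lattice_path_def)
  show ?thesis
    unfolding weighted_set_dist_def
    by (intro borel_measurable_INF A count borel_measurable_ereal path) (auto simp: lattice_path_def)
qed

lemma unit_cube_subset_grid:
  assumes "0 < \<epsilon>"
  shows "unit_cube \<epsilon> \<subseteq> (\<lambda>f. \<chi> i. \<epsilon> * real (f i)) ` (Pi\<^sub>E UNIV (\<lambda>_::'n::finite. {..nat \<lfloor>1 / \<epsilon>\<rfloor>}))"
proof
  fix x :: "real^'n" assume x: "x \<in> unit_cube \<epsilon>"
  then have "\<forall>i. \<exists>k::int. x $ i = \<epsilon> * of_int k"
    by (simp add: unit_cube_def scaled_lattice_def)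
  then obtain k :: "'n \<Rightarrow> int" where k: "\<And>i. x $ i = \<epsilon> * of_int (k i)" by metis
  have "0 \<le> k i" "k i \<le> \<lfloor>1 / \<epsilon>\<rfloor>" for i
  proof -
    have "0 \<le> \<epsilon> * of_int (k i)" "\<epsilon> * of_int (k i) \<le> 1"
      using x unfolding k[symmetric] by (auto simp: unit_cube_def)
    then show "0 \<le> k i" "k i \<le> \<lfloor>1 / \<epsilon>\<rfloor>"
      using assms by (auto simp: zero_le_mult_iff le_floor_iff field_simps)
  qed
  then have "(\<lambda>i. nat (k i)) \<in> Pi\<^sub>E UNIV (\<lambda>_. {..nat \<lfloor>1 / \<epsilon>\<rfloor>})" "x = (\<chi> i. \<epsilon> * real (nat (k i)))"
    by (auto simp: vec_eq_iff k nat_mono)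
  then show "x \<in> (\<lambda>f. \<chi> i. \<epsilon> * real (f i)) ` (Pi\<^sub>E UNIV (\<lambda>_. {..nat \<lfloor>1 / \<epsilon>\<rfloor>}))"
    by (intro image_eqI[where x="\<lambda>i. nat (k i)"])
qed

lemma finite_unit_cube:
  assumes "0 < \<epsilon>"
  shows "finite (unit_cube \<epsilon> :: (real^'n) set)"
  by (rule finite_subset[OF unit_cube_subset_grid[OF assms]]) (intro finite_imageI finite_PiE; simp)

lemma card_unit_cube_le:
  assumes "0 < \<epsilon>" "\<epsilon> \<le> 1"
  shows "real (card (unit_cube \<epsilon> :: (real^'n) set)) \<le> (2 / \<epsilon>) ^ CARD('n)"
proof -
  let ?G = "Pi\<^sub>E UNIV (\<lambda>_::'n::finite. {..nat \<lfloor>1 / \<epsilon>\<rfloor>})"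
  have fin: "finite ?G" by (intro finite_PiE; simp)
  have "card (unit_cube \<epsilon> :: (real^'n) set) \<le> card ?G"
    using card_mono[OF finite_imageI[OF fin] unit_cube_subset_grid[OF assms(1)]] card_image_le[OF fin]
    by (rule order.trans)
  also have "card ?G = (nat \<lfloor>1 / \<epsilon>\<rfloor> + 1) ^ CARD('n)"
    by (simp add: card_PiE)
  finally have "real (card (unit_cube \<epsilon> :: (real^'n) set)) \<le> real ((nat \<lfloor>1 / \<epsilon>\<rfloor> + 1) ^ CARD('n))"
    by (rule of_nat_mono)
  also have "\<dots> = (real (nat \<lfloor>1 / \<epsilon>\<rfloor>) + 1) ^ CARD('n)" by (simp add: add.commute)
  also have "\<dots> \<le> (2 / \<epsilon>) ^ CARD('n)"
  proof (rule power_mono)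
    have "real (nat \<lfloor>1 / \<epsilon>\<rfloor>) \<le> 1 / \<epsilon>" using assms by simp
    also have "1 / \<epsilon> + 1 \<le> 2 / \<epsilon>" using assms by (simp add: field_simps)
    finally show "real (nat \<lfloor>1 / \<epsilon>\<rfloor>) + 1 \<le> 2 / \<epsilon>" by simp
  qed simp
  finally show ?thesis .
qed

lemma coord_embed_unit_cube:
  assumes "inj e" "x \<in> unit_cube \<epsilon>"
  shows "coord_embed e x \<in> unit_cube \<epsilon>"
  using assms unfolding unit_cube_def scaled_lattice_def coord_embed_def
  by (auto intro: exI[of _ "0::int"])

text \<open>An embedded crossing is again a crossing, because the embedding preserves the mesh, the lattice and
the first coordinate; its length grows at most by the factor \<open>exp (\<xi> * a)\<close>. The infimum over paths
is only approached up to an error, which avoids a separate argument that it is attained.\<close>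

lemma weighted_set_dist_coord_embed_le:
  fixes e :: "'n::{finite,linorder} \<Rightarrow> 'm::{finite,linorder}"
  assumes e: "inj e" "e (Min UNIV) = Min UNIV" and \<epsilon>: "0 < \<epsilon>" and \<xi>: "0 \<le> \<xi>"
    and le: "\<And>x. x \<in> unit_cube \<epsilon> \<Longrightarrow> g' (coord_embed e x) \<le> g x + a"
    and g: "weighted_set_dist \<epsilon> \<xi> g (left_face \<epsilon>) (right_face \<epsilon>) (unit_cube \<epsilon>) \<le> ereal c"
  shows "weighted_set_dist \<epsilon> \<xi> g' (left_face \<epsilon>) (right_face \<epsilon>) (unit_cube \<epsilon>) \<le> ereal (exp (\<xi> * a) * c)"
proof (rule ereal_le_epsilon2)
  fix \<eta> :: real assume \<eta>: "0 < \<eta>"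
  \<comment> \<open>This error, multiplied by the growth factor of the length, becomes \<open>\<eta>\<close>.\<close>
  define \<theta> where "\<theta> = \<eta> / exp (\<xi> * a)"
  have "weighted_set_dist \<epsilon> \<xi> g (left_face \<epsilon>) (right_face \<epsilon>) (unit_cube \<epsilon>) < ereal (c + \<theta>)"
    using g \<eta> by (auto simp: \<theta>_def intro: le_less_trans)
  then obtain z w P where zw: "z \<in> left_face \<epsilon>" "w \<in> right_face \<epsilon>"
    and P: "lattice_path \<epsilon> (unit_cube \<epsilon>) z w P" and len: "(\<Sum>x\<leftarrow>P. \<epsilon> * exp (\<xi> * g x)) < c + \<theta>"
    unfolding weighted_set_dist_def by (auto simp: INF_less_iff)
  let ?\<iota> = "coord_embed e"
  have zw': "?\<iota> z \<in> left_face \<epsilon>" "?\<iota> w \<in> right_face \<epsilon>"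
    using zw coord_embed_unit_cube[OF e(1)] coord_embed_nth[OF e(1), of _ "Min UNIV"] e(2)
    by (auto simp: left_face_def right_face_def)
  have P': "lattice_path \<epsilon> (unit_cube \<epsilon>) (?\<iota> z) (?\<iota> w) (map ?\<iota> P)"
    using P coord_embed_unit_cube[OF e(1)]
    by (auto simp: lattice_path_def hd_map last_map dist_coord_embed[OF e(1)])
  have "weighted_set_dist \<epsilon> \<xi> g' (left_face \<epsilon>) (right_face \<epsilon>) (unit_cube \<epsilon>)
      \<le> ereal (\<Sum>x\<leftarrow>map ?\<iota> P. \<epsilon> * exp (\<xi> * g' x))"
    unfolding weighted_set_dist_def using zw' P'
    by (intro INF_lower2[where i="?\<iota> z"] INF_lower2[where i="?\<iota> w"]
        INF_lower2[where i="map ?\<iota> P"]) auto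
  also have "(\<Sum>x\<leftarrow>map ?\<iota> P. \<epsilon> * exp (\<xi> * g' x)) \<le> (\<Sum>x\<leftarrow>P. exp (\<xi> * a) * (\<epsilon> * exp (\<xi> * g x)))"
    unfolding map_map comp_def
  proof (rule sum_list_mono)
    fix x assume "x \<in> set P"
    then have "\<xi> * g' (?\<iota> x) \<le> \<xi> * (g x + a)"
      using P le[of x] \<xi> by (intro mult_left_mono) (auto simp: lattice_path_def)
    then have "exp (\<xi> * g' (?\<iota> x)) \<le> exp (\<xi> * a) * exp (\<xi> * g x)"
      by (simp add: exp_add[symmetric] algebra_simps)
    then show "\<epsilon> * exp (\<xi> * g' (?\<iota> x)) \<le> exp (\<xi> * a) * (\<epsilon> * exp (\<xi> * g x))"
      using \<epsilon> by simp
  qed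
  also have "\<dots> = exp (\<xi> * a) * (\<Sum>x\<leftarrow>P. \<epsilon> * exp (\<xi> * g x))"
    by (simp add: sum_list_const_mult)
  also have "\<dots> \<le> exp (\<xi> * a) * (c + \<theta>)"
    using len by (intro mult_left_mono) auto
  also have "\<dots> = exp (\<xi> * a) * c + \<eta>"
    by (simp add: \<theta>_def distrib_left)
  finally show "weighted_set_dist \<epsilon> \<xi> g' (left_face \<epsilon>) (right_face \<epsilon>) (unit_cube \<epsilon>)
      \<le> ereal (exp (\<xi> * a) * c) + ereal \<eta>"
    by simp
qed

section \<open>The field on a coordinate subspace\<close>

definition box_pair :: "real \<Rightarrow> real^'n \<Rightarrow> (real^'n) signed_pair" where
  "box_pair \<epsilon> x = (box_measure \<epsilon> x, sphere_unif)"

lemma box_average_eq: "box_average h \<epsilon> x = h (box_pair \<epsilon> x)"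
  by (simp add: box_average_def pairing_def box_pair_def box_measure_def)

definition push_pair :: "('a::euclidean_space \<Rightarrow> 'b::euclidean_space) \<Rightarrow> 'a signed_pair \<Rightarrow> 'b signed_pair" where
  "push_pair \<iota> \<rho> = (distr (fst \<rho>) borel \<iota>, distr (snd \<rho>) borel \<iota>)"

lemma zero_mass_pairI:
  assumes "prob_space \<mu>" "sets \<mu> = sets borel" "finite_log_energy \<mu>"
    and "prob_space \<nu>" "sets \<nu> = sets borel" "finite_log_energy \<nu>"
  shows "(\<mu>, \<nu>) \<in> zero_mass_pairs"
proof -
  have "emeasure \<mu> UNIV = 1" "emeasure \<nu> UNIV = 1"
    using prob_space.emeasure_space_1[OF assms(1)] prob_space.emeasure_space_1[OF assms(4)]
      sets_eq_imp_space_eq[OF assms(2)] sets_eq_imp_space_eq[OF assms(5)] by simp_all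
  then show ?thesis
    using assms by (simp add: zero_mass_pairs_def prob_space.finite_measure)
qed

lemma box_pair_zero_mass:
  fixes x :: "real^'n"
  assumes "2 \<le> CARD('n)" "0 < \<epsilon>"
  shows "box_pair \<epsilon> x \<in> zero_mass_pairs"
  unfolding box_pair_def using assms
  by (intro zero_mass_pairI prob_space_box_measure finite_log_energy_box_measure
      prob_space_sphere_unif finite_log_energy_sphere_unif) auto

lemma push_pair_zero_mass:
  assumes iso: "\<And>x y. dist (\<iota> x) (\<iota> y) = dist x y" and \<iota> [measurable]: "\<iota> \<in> borel_measurable borel"
    and \<rho>: "\<rho> \<in> zero_mass_pairs"
  shows "push_pair \<iota> \<rho> \<in> zero_mass_pairs"
proof -
  obtain \<mu> \<nu> where [simp]: "\<rho> = (\<mu>, \<nu>)" by (cases \<rho>)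
  have s: "sets \<mu> = sets borel" "sets \<nu> = sets borel" and fin: "finite_measure \<mu>" "finite_measure \<nu>"
    "finite_log_energy \<mu>" "finite_log_energy \<nu>" and mass: "emeasure \<mu> UNIV = emeasure \<nu> UNIV"
    using \<rho> by (auto simp: zero_mass_pairs_def)
  note [measurable_cong] = s
  have "space \<mu> = UNIV" "space \<nu> = UNIV"
    using sets_eq_imp_space_eq[OF s(1)] sets_eq_imp_space_eq[OF s(2)] by auto
  then have "emeasure (distr \<mu> borel \<iota>) UNIV = emeasure (distr \<nu> borel \<iota>) UNIV"
    using mass by (simp add: emeasure_distr)
  moreover have "finite_measure (distr \<mu> borel \<iota>)" "finite_measure (distr \<nu> borel \<iota>)"
    by (intro finite_measure.finite_measure_distr fin; measurable)+
  ultimately show ?thesis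
    using finite_log_energy_distr_isometry[OF _ _ _ iso \<iota>] s fin
    by (simp add: push_pair_def zero_mass_pairs_def)
qed

lemma log_covariance_push_pair:
  assumes iso: "\<And>x y. dist (\<iota> x) (\<iota> y) = dist x y" and \<iota>: "\<iota> \<in> borel_measurable borel"
    and "\<rho> \<in> zero_mass_pairs" "\<tau> \<in> zero_mass_pairs"
  shows "log_covariance (push_pair \<iota> \<rho>) (push_pair \<iota> \<tau>) = log_covariance \<rho> \<tau>"
  using assms(3,4) log_energy_distr_isometry[OF _ _ _ _ iso \<iota>]
  by (auto simp: log_covariance_def push_pair_def zero_mass_pairs_def)

lemma LGF_D:
  assumes "whole_space_LGF M h"
  shows "prob_space M" "centered_gaussian_process M zero_mass_pairs h"
    "\<And>\<rho> \<tau>. \<rho> \<in> zero_mass_pairs \<Longrightarrow> \<tau> \<in> zero_mass_pairs \<Longrightarrow> covariance M (h \<rho>) (h \<tau>) = log_covariance \<rho> \<tau>"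
  using assms by (auto simp: whole_space_LGF_def)

lemma LGF_increment:
  assumes h: "whole_space_LGF M h" and pq: "p \<in> zero_mass_pairs" "q \<in> zero_mass_pairs"
  shows "centered_gaussian M (\<lambda>\<omega>. h p \<omega> - h q \<omega>)"
    and "(\<integral>\<omega>. (h p \<omega> - h q \<omega>)\<^sup>2 \<partial>M)
      = log_covariance p p - log_covariance p q - log_covariance q p + log_covariance q q"
proof -
  note H = LGF_D[OF h]
  let ?r = "\<lambda>b. if b then p else q" and ?c = "\<lambda>b. if b then 1 else (- 1 :: real)"
  have proc: "centered_gaussian_process M UNIV (\<lambda>b. h (?r b))"
    by (rule centered_gaussian_process_reindex[OF H(2)]) (use pq in auto)
  have eq: "(\<Sum>b\<in>UNIV. ?c b * h (?r b) \<omega>) = h p \<omega> - h q \<omega>" for \<omega>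
    by (simp add: UNIV_bool)
  have "centered_gaussian M (\<lambda>\<omega>. \<Sum>b\<in>UNIV. ?c b * h (?r b) \<omega>)"
    using proc unfolding centered_gaussian_process_def by auto
  then show "centered_gaussian M (\<lambda>\<omega>. h p \<omega> - h q \<omega>)"
    unfolding eq .
  have "(\<integral>\<omega>. (\<Sum>b\<in>UNIV. ?c b * h (?r b) \<omega>)\<^sup>2 \<partial>M)
      = (\<Sum>k\<in>UNIV. \<Sum>l\<in>UNIV. ?c k * ?c l * covariance M (h (?r k)) (h (?r l)))"
    by (rule second_moment_linear_combination[OF H(1) proc]) simp
  then show "(\<integral>\<omega>. (h p \<omega> - h q \<omega>)\<^sup>2 \<partial>M)
      = log_covariance p p - log_covariance p q - log_covariance q p + log_covariance q q"
    unfolding eq using pq by (simp add: UNIV_bool H(3))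
qed

text \<open>The left-hand side is the energy of \<open>(A - B) + (T - S)\<close>, as \<open>A - S\<close> and \<open>B - T\<close> are the signed
measures tested. The logarithmic energy of signed measures of mass zero is nonnegative, being a
variance of the field, so the energy of a sum is at most twice the sum of the energies. In this way
the boxes are compared with the boxes and the spheres with the spheres, and no mixed energy between
a small box and a sphere has to be estimated.\<close>

lemma LGF_renormalised_increment_le:
  assumes h: "whole_space_LGF M h"
    and A: "prob_space A" "sets A = sets borel" "finite_log_energy A"
    and B: "prob_space B" "sets B = sets borel" "finite_log_energy B"
    and S: "prob_space S" "sets S = sets borel" "finite_log_energy S"
    and T: "prob_space T" "sets T = sets borel" "finite_log_energy T"
  shows "(\<integral>\<omega>. (h (A, S) \<omega> - h (B, T) \<omega>)\<^sup>2 \<partial>M)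
    \<le> 2 * log_covariance (A, B) (A, B) + 2 * log_covariance (T, S) (T, S)"
proof -
  note zm = zero_mass_pairI
  have sym: "log_energy B A = log_energy A B" "log_energy S A = log_energy A S"
    "log_energy T A = log_energy A T" "log_energy S B = log_energy B S"
    "log_energy T B = log_energy B T" "log_energy T S = log_energy S T"
    by (intro log_energy_commute A B S T)+
  have "0 \<le> (\<integral>\<omega>. (h (A, B) \<omega> - h (T, S) \<omega>)\<^sup>2 \<partial>M)"
    by simp
  then show ?thesis
    unfolding LGF_increment(2)[OF h zm[OF A S] zm[OF B T]] LGF_increment(2)[OF h zm[OF A B] zm[OF T S]]
    by (simp add: log_covariance_def sym)
qed

text \<open>The full box and the flat embedded box have the same centre, the same diameter up to a constant, and
linear growth at scale \<open>\<epsilon>\<close>. Each of their four mutual energies is therefore \<open>log (1 / \<epsilon>)\<close> up to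
a constant independent of \<open>\<epsilon>\<close> and the centre, and the logarithm cancels in the energy of their
difference. The two spheres contribute a fixed constant.\<close>

lemma box_average_increment_bounded:
  fixes h' :: "(real^'m) signed_pair \<Rightarrow> 'v \<Rightarrow> real" and e :: "'n::finite \<Rightarrow> 'm"
  assumes h': "whole_space_LGF M' h'" and e: "inj e" and n: "2 \<le> CARD('n)" and m: "2 \<le> CARD('m)"
  obtains v where "\<And>\<epsilon> x. 0 < \<epsilon> \<Longrightarrow>
    (\<integral>\<omega>. (h' (box_pair \<epsilon> (coord_embed e x)) \<omega> - h' (push_pair (coord_embed e) (box_pair \<epsilon> x)) \<omega>)\<^sup>2 \<partial>M') \<le> v"
proof
  let ?\<iota> = "coord_embed e"
  let ?S = "sphere_unif :: (real^'m) measure" and ?T = "distr sphere_unif borel ?\<iota> :: (real^'m) measure"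
  define R where "R = 1 / (1 - exp (- 1)) + 2 * real CARD('m)"
  fix \<epsilon> :: real and x :: "real^'n" assume \<epsilon>: "0 < \<epsilon>"
  note iso = dist_coord_embed[OF e] and meas [measurable] = measurable_coord_embed[OF e]
  have nm: "CARD('n) \<le> CARD('m)"
    using card_inj_on_le[OF e, of UNIV] by simp
  define A where "A = box_measure \<epsilon> (?\<iota> x)"
  define B where "B = distr (box_measure \<epsilon> x) borel ?\<iota>"
  have A: "prob_space A" "sets A = sets borel" "finite_log_energy A"
    using \<epsilon> by (simp_all add: A_def prob_space_box_measure finite_log_energy_box_measure)
  have B: "prob_space B" "sets B = sets borel" "finite_log_energy B"
  proof -
    show "prob_space B" unfolding B_def
      by (rule prob_space.prob_space_distr[OF prob_space_box_measure[OF \<epsilon>]]) measurable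
    show "finite_log_energy B" unfolding B_def using \<epsilon>
      by (intro finite_log_energy_distr_isometry iso meas finite_log_energy_box_measure
          prob_space.finite_measure prob_space_box_measure) auto
  qed (simp add: B_def)
  have S: "prob_space ?S" "sets ?S = sets borel" "finite_log_energy ?S"
    using m by (simp_all add: prob_space_sphere_unif finite_log_energy_sphere_unif)
  have T: "prob_space ?T" "sets ?T = sets borel" "finite_log_energy ?T"
  proof -
    show "prob_space ?T"
      by (rule prob_space.prob_space_distr[OF prob_space_sphere_unif]) measurable
    show "finite_log_energy ?T" using n
      by (intro finite_log_energy_distr_isometry iso meas finite_log_energy_sphere_unif
          prob_space.finite_measure prob_space_sphere_unif) auto
  qed simp
  have growth: "emeasure A (cball p (\<epsilon> * t)) \<le> ennreal (1 * t)"
    "emeasure B (cball p (\<epsilon> * t)) \<le> ennreal (1 * t)" if t: "0 < t" for p t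
  proof -
    show "emeasure A (cball p (\<epsilon> * t)) \<le> ennreal (1 * t)"
      using box_measure_growth[OF \<epsilon> t] by (simp add: A_def)
    let ?q = "(\<chi> i. p $ e i) :: real^'n"
    have "\<bar>y $ i - ?q $ i\<bar> \<le> \<epsilon> * t" if "?\<iota> y \<in> cball p (\<epsilon> * t)" for y i
      using component_le_norm_cart[of "?\<iota> y - p" "e i"] that e
      by (simp add: dist_norm norm_minus_commute)
    moreover have "{y::real^'n. \<forall>i. \<bar>y $ i - ?q $ i\<bar> \<le> \<epsilon> * t} \<in> sets borel"
      by measurable
    ultimately have "emeasure (box_measure \<epsilon> x) (?\<iota> -` cball p (\<epsilon> * t) \<inter> UNIV)
        \<le> emeasure (box_measure \<epsilon> x) {y. \<forall>i. \<bar>y $ i - ?q $ i\<bar> \<le> \<epsilon> * t}"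
      by (intro emeasure_mono) auto
    also have "\<dots> \<le> ennreal t" by (rule box_measure_cube_le[OF \<epsilon> t])
    finally show "emeasure B (cball p (\<epsilon> * t)) \<le> ennreal (1 * t)"
      by (simp add: B_def emeasure_distr)
  qed
  have supp: "AE y in A. dist (?\<iota> x) y \<le> real CARD('m) * \<epsilon>" "AE y in B. dist (?\<iota> x) y \<le> real CARD('m) * \<epsilon>"
  proof -
    show "AE y in A. dist (?\<iota> x) y \<le> real CARD('m) * \<epsilon>"
      unfolding A_def by (rule box_measure_support[OF \<epsilon>])
    have "AE y in box_measure \<epsilon> x. dist (?\<iota> x) (?\<iota> y) \<le> real CARD('m) * \<epsilon>"
      using box_measure_support[OF \<epsilon>, of x]
    proof eventually_elim
      fix y assume "dist x y \<le> real CARD('n) * \<epsilon>"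
      also have "\<dots> \<le> real CARD('m) * \<epsilon>" using nm \<epsilon> by (intro mult_right_mono) auto
      finally show "dist (?\<iota> x) (?\<iota> y) \<le> real CARD('m) * \<epsilon>" by (simp add: iso)
    qed
    then show "AE y in B. dist (?\<iota> x) y \<le> real CARD('m) * \<epsilon>"
      unfolding B_def by (subst AE_distr_iff) auto
  qed
  have near: "\<bar>log_energy A A - ln (1 / \<epsilon>)\<bar> \<le> R" "\<bar>log_energy A B - ln (1 / \<epsilon>)\<bar> \<le> R"
    "\<bar>log_energy B A - ln (1 / \<epsilon>)\<bar> \<le> R" "\<bar>log_energy B B - ln (1 / \<epsilon>)\<bar> \<le> R"
    unfolding R_def
    by (rule log_energy_near_log_scale[where a="?\<iota> x", OF _ _ _ _ \<epsilon>]; use A B growth supp in simp)+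
  have "(\<integral>\<omega>. (h' (A, ?S) \<omega> - h' (B, ?T) \<omega>)\<^sup>2 \<partial>M')
      \<le> 2 * log_covariance (A, B) (A, B) + 2 * log_covariance (?T, ?S) (?T, ?S)"
    by (rule LGF_renormalised_increment_le[OF h' A B S T])
  also have "log_covariance (A, B) (A, B) \<le> 4 * R"
    using near by (simp add: log_covariance_def)
  finally show "(\<integral>\<omega>. (h' (box_pair \<epsilon> (?\<iota> x)) \<omega> - h' (push_pair ?\<iota> (box_pair \<epsilon> x)) \<omega>)\<^sup>2 \<partial>M')
      \<le> 2 * (4 * (1 / (1 - exp (- 1)) + 2 * real CARD('m))) + 2 * log_covariance (?T, ?S) (?T, ?S)"
    by (simp add: box_pair_def push_pair_def A_def B_def R_def)
qed

lemma finite_gaussian_family_max_tail: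
  assumes M: "prob_space M" and S: "finite S" and Z: "\<And>x. x \<in> S \<Longrightarrow> centered_gaussian M (Z x)"
    and v: "\<And>x. x \<in> S \<Longrightarrow> (\<integral>\<omega>. (Z x \<omega>)\<^sup>2 \<partial>M) \<le> v" and u: "0 \<le> u"
  shows "measure M (\<Union>x\<in>S. {\<omega> \<in> space M. t < Z x \<omega>}) \<le> real (card S) * exp (u\<^sup>2 * v / 2 - u * t)"
proof -
  interpret prob_space M by fact
  have [measurable]: "Z x \<in> borel_measurable M" if "x \<in> S" for x
    using Z[OF that] by (simp add: centered_gaussian_def)
  have "measure M (\<Union>x\<in>S. {\<omega> \<in> space M. t < Z x \<omega>}) \<le> (\<Sum>x\<in>S. measure M {\<omega> \<in> space M. t < Z x \<omega>})"
    by (rule measure_UNION_le[OF S]) measurable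
  also have "\<dots> \<le> (\<Sum>x\<in>S. exp (u\<^sup>2 * v / 2 - u * t))"
    by (intro sum_mono centered_gaussian_tail[OF M Z v u])
  finally show ?thesis by simp
qed

text \<open>The embedding preserves the log covariance, so on the finitely many lattice points the flat box
averages of the higher-dimensional field have the joint law of the box averages of the
lower-dimensional one, and the crossing event is a measurable function of these values.\<close>

lemma crossing_prob_restriction:
  fixes h :: "(real^'n::{finite,linorder}) signed_pair \<Rightarrow> 'w \<Rightarrow> real"
    and h' :: "(real^'m::{finite,linorder}) signed_pair \<Rightarrow> 'v \<Rightarrow> real"
  assumes h: "whole_space_LGF M h" and h': "whole_space_LGF M' h'"
    and n: "2 \<le> CARD('n)" and e: "inj (e :: 'n \<Rightarrow> 'm)" and \<epsilon>: "0 < \<epsilon>"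
  shows "crossing_prob M h \<xi> \<alpha> \<epsilon> = measure M' {\<omega> \<in> space M'.
    weighted_set_dist \<epsilon> \<xi> (\<lambda>x. h' (push_pair (coord_embed e) (box_pair \<epsilon> x)) \<omega>)
      (left_face \<epsilon>) (right_face \<epsilon>) (unit_cube \<epsilon>) \<le> ereal (\<epsilon> powr \<alpha>)}"
proof -
  let ?\<iota> = "coord_embed e" and ?K = "unit_cube \<epsilon> :: (real, 'n) vec set"
  let ?F = "\<lambda>g. weighted_set_dist \<epsilon> \<xi> g (left_face \<epsilon>) (right_face \<epsilon>) ?K"
  let ?E = "{g \<in> space (Pi\<^sub>M ?K (\<lambda>_. borel)). ?F g \<le> ereal (\<epsilon> powr \<alpha>)}"
  note iso = dist_coord_embed[OF e] and meas = measurable_coord_embed[OF e]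
  have fin: "finite ?K" by (rule finite_unit_cube[OF \<epsilon>])
  have "left_face \<epsilon> \<subseteq> ?K" "right_face \<epsilon> \<subseteq> ?K" by (auto simp: left_face_def right_face_def)
  then have count: "countable ?K" "countable (left_face \<epsilon> :: (real, 'n) vec set)" "countable (right_face \<epsilon> :: (real, 'n) vec set)"
    using fin by (auto intro: countable_finite finite_subset)
  have F: "?F \<in> borel_measurable (Pi\<^sub>M ?K (\<lambda>_. borel))"
    by (rule borel_measurable_weighted_set_dist[OF count]) measurable
  have E: "?E \<in> sets (Pi\<^sub>M ?K (\<lambda>_. borel))"
    using borel_measurable_le[OF F borel_measurable_const] .
  have event: "measure N {\<omega> \<in> space N. ?F (\<lambda>x. X x \<omega>) \<le> ereal (\<epsilon> powr \<alpha>)}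
      = measure (distr N (Pi\<^sub>M ?K (\<lambda>_. borel)) (\<lambda>\<omega>. \<lambda>x\<in>?K. X x \<omega>)) ?E"
    if X: "centered_gaussian_process N ?K X" for N :: "'c measure" and X
  proof -
    have [measurable]: "(\<lambda>\<omega>. \<lambda>x\<in>?K. X x \<omega>) \<in> measurable N (Pi\<^sub>M ?K (\<lambda>_. borel))"
      using centered_gaussian_process_component[OF X]
      by (intro measurable_restrict) (simp add: centered_gaussian_def)
    have eq: "?F (\<lambda>x. X x \<omega>) = ?F (\<lambda>x\<in>?K. X x \<omega>)" for \<omega>
      by (rule weighted_set_dist_cong) simp
    have "(\<lambda>\<omega>. \<lambda>x\<in>?K. X x \<omega>) -` ?E \<inter> space N
        = {\<omega> \<in> space N. ?F (\<lambda>x\<in>?K. X x \<omega>) \<le> ereal (\<epsilon> powr \<alpha>)}"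
      by (auto simp: space_PiM)
    also have "\<dots> = {\<omega> \<in> space N. ?F (\<lambda>x. X x \<omega>) \<le> ereal (\<epsilon> powr \<alpha>)}"
      unfolding eq ..
    finally have pre: "(\<lambda>\<omega>. \<lambda>x\<in>?K. X x \<omega>) -` ?E \<inter> space N
        = {\<omega> \<in> space N. ?F (\<lambda>x. X x \<omega>) \<le> ereal (\<epsilon> powr \<alpha>)}" .
    have "measure (distr N (Pi\<^sub>M ?K (\<lambda>_. borel)) (\<lambda>\<omega>. \<lambda>x\<in>?K. X x \<omega>)) ?E
        = measure N ((\<lambda>\<omega>. \<lambda>x\<in>?K. X x \<omega>) -` ?E \<inter> space N)"
      by (rule measure_distr[OF _ E]) measurable
    then show ?thesis
      unfolding pre ..
  qed
  note H = LGF_D[OF h] and H' = LGF_D[OF h']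
  note zm = box_pair_zero_mass[OF n \<epsilon>]
  note zm' = push_pair_zero_mass[OF iso meas zm]
  have X: "centered_gaussian_process M ?K (\<lambda>x. h (box_pair \<epsilon> x))"
    by (rule centered_gaussian_process_reindex[OF H(2)]) (use zm in auto)
  have Y: "centered_gaussian_process M' ?K (\<lambda>x. h' (push_pair ?\<iota> (box_pair \<epsilon> x)))"
    by (rule centered_gaussian_process_reindex[OF H'(2)]) (use zm' in auto)
  have "distr M (Pi\<^sub>M ?K (\<lambda>_. borel)) (\<lambda>\<omega>. \<lambda>x\<in>?K. h (box_pair \<epsilon> x) \<omega>)
      = distr M' (Pi\<^sub>M ?K (\<lambda>_. borel)) (\<lambda>\<omega>. \<lambda>x\<in>?K. h' (push_pair ?\<iota> (box_pair \<epsilon> x)) \<omega>)"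
    by (rule gaussian_law_determined_by_covariance[OF H(1) X H'(1) Y fin])
      (simp add: H(3) H'(3) zm zm' log_covariance_push_pair[OF iso meas])
  then show ?thesis
    using event[OF X] event[OF Y]
    by (simp only: crossing_prob_def lfpp_set_dist_eq_weighted box_average_eq)
qed

section \<open>Comparison of the exponents\<close>

text \<open>Off the event that some full box average exceeds the corresponding flat one by more than
\<open>a = \<delta> * ln (1 / \<epsilon>)\<close>, a cheap flat crossing yields a crossing whose length is larger by a factor of at most
\<open>exp (\<xi> * a) = \<epsilon> powr (- \<xi> * \<delta>)\<close>.\<close>

lemma crossing_prob_le_higher_dimension:
  fixes h :: "(real^'n::{finite,linorder}) signed_pair \<Rightarrow> 'w \<Rightarrow> real"
    and h' :: "(real^'m::{finite,linorder}) signed_pair \<Rightarrow> 'v \<Rightarrow> real"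
  assumes h: "whole_space_LGF M h" and h': "whole_space_LGF M' h'"
    and n: "2 \<le> CARD('n)" and e: "inj (e :: 'n \<Rightarrow> 'm)" "e (Min UNIV) = Min UNIV"
    and \<epsilon>: "0 < \<epsilon>" "\<epsilon> \<le> 1" and \<xi>: "0 \<le> \<xi>" and u: "0 \<le> u"
    and v: "\<And>x. (\<integral>\<omega>. (h' (box_pair \<epsilon> (coord_embed e x)) \<omega>
        - h' (push_pair (coord_embed e) (box_pair \<epsilon> x)) \<omega>)\<^sup>2 \<partial>M') \<le> v"
  shows "crossing_prob M h \<xi> \<alpha> \<epsilon> \<le> crossing_prob M' h' \<xi> (\<alpha> - \<xi> * \<delta>) \<epsilon>
    + (2 / \<epsilon>) ^ CARD('n) * exp (u\<^sup>2 * v / 2 - u * (\<delta> * ln (1 / \<epsilon>)))"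
proof -
  let ?\<iota> = "coord_embed e" and ?K = "unit_cube \<epsilon> :: (real, 'n) vec set" and ?K' = "unit_cube \<epsilon> :: (real, 'm) vec set"
  note H' = LGF_D[OF h']
  interpret prob_space M' by (rule H'(1))
  note iso = dist_coord_embed[OF e(1)] and meas = measurable_coord_embed[OF e(1)]
  have m: "2 \<le> CARD('m)"
    using card_inj_on_le[OF e(1), of UNIV] n by simp
  define a where "a = \<delta> * ln (1 / \<epsilon>)"
  define X where "X x = h' (box_pair \<epsilon> x)" for x
  define Y where "Y x = h' (push_pair ?\<iota> (box_pair \<epsilon> x))" for x
  define G where "G = {\<omega> \<in> space M'. weighted_set_dist \<epsilon> \<xi> (\<lambda>x. Y x \<omega>)
      (left_face \<epsilon>) (right_face \<epsilon>) ?K \<le> ereal (\<epsilon> powr \<alpha>)}"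
  define G' where "G' = {\<omega> \<in> space M'. weighted_set_dist \<epsilon> \<xi> (\<lambda>x. X x \<omega>)
      (left_face \<epsilon>) (right_face \<epsilon>) ?K' \<le> ereal (\<epsilon> powr (\<alpha> - \<xi> * \<delta>))}"
  define Bad where "Bad = (\<Union>x\<in>?K. {\<omega> \<in> space M'. a < X (?\<iota> x) \<omega> - Y x \<omega>})"
  have Z: "centered_gaussian M' (\<lambda>\<omega>. X (?\<iota> x) \<omega> - Y x \<omega>)" for x
    unfolding X_def Y_def
    by (rule LGF_increment(1)[OF h' box_pair_zero_mass[OF m \<epsilon>(1)]
          push_pair_zero_mass[OF iso meas box_pair_zero_mass[OF n \<epsilon>(1)]]])
  have "exp (\<xi> * a) * \<epsilon> powr \<alpha> = \<epsilon> powr (\<alpha> - \<xi> * \<delta>)"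
    using \<epsilon> by (simp add: a_def powr_def ln_div exp_add[symmetric] algebra_simps)
  note scale = this
  have "G \<subseteq> G' \<union> Bad"
  proof
    fix \<omega> assume G: "\<omega> \<in> G"
    show "\<omega> \<in> G' \<union> Bad"
    proof (cases "\<omega> \<in> Bad")
      case False
      have "X (?\<iota> x) \<omega> \<le> Y x \<omega> + a" if "x \<in> ?K" for x
      proof (rule ccontr)
        assume "\<not> X (?\<iota> x) \<omega> \<le> Y x \<omega> + a"
        then have "\<omega> \<in> {\<omega> \<in> space M'. a < X (?\<iota> x) \<omega> - Y x \<omega>}"
          using G by (simp add: G_def)
        then show False
          using False that unfolding Bad_def by blast
      qed
      moreover have "weighted_set_dist \<epsilon> \<xi> (\<lambda>x. Y x \<omega>) (left_face \<epsilon>) (right_face \<epsilon>) ?K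
          \<le> ereal (\<epsilon> powr \<alpha>)"
        using G by (simp add: G_def)
      ultimately have "weighted_set_dist \<epsilon> \<xi> (\<lambda>x. X x \<omega>) (left_face \<epsilon>) (right_face \<epsilon>) ?K'
          \<le> ereal (exp (\<xi> * a) * \<epsilon> powr \<alpha>)"
        by (rule weighted_set_dist_coord_embed_le[OF e \<epsilon>(1) \<xi>])
      then show ?thesis
        using G unfolding scale by (simp add: G_def G'_def)
    qed simp
  qed
  moreover have meas_G': "G' \<in> sets M'"
  proof -
    have "(left_face \<epsilon> :: (real, 'm) vec set) \<subseteq> ?K'" "(right_face \<epsilon> :: (real, 'm) vec set) \<subseteq> ?K'"
      by (auto simp: left_face_def right_face_def)
    then have count: "countable ?K'" "countable (left_face \<epsilon> :: (real, 'm) vec set)" "countable (right_face \<epsilon> :: (real, 'm) vec set)"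
      using finite_unit_cube[OF \<epsilon>(1)] by (auto intro: countable_finite finite_subset)
    have "X x \<in> borel_measurable M'" for x
      using centered_gaussian_process_component[OF H'(2) box_pair_zero_mass[OF m \<epsilon>(1), of x]]
      by (simp add: X_def centered_gaussian_def)
    then have "(\<lambda>\<omega>. weighted_set_dist \<epsilon> \<xi> (\<lambda>x. X x \<omega>) (left_face \<epsilon>) (right_face \<epsilon>) ?K') \<in> borel_measurable M'"
      by (intro borel_measurable_weighted_set_dist[OF count])
    then show ?thesis
      unfolding G'_def by (rule borel_measurable_le) simp
  qed
  moreover have meas_Bad: "Bad \<in> sets M'"
  proof -
    have "(\<lambda>\<omega>. X (?\<iota> x) \<omega> - Y x \<omega>) \<in> borel_measurable M'" for x
      using Z[of x] by (simp add: centered_gaussian_def)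
    then have "{\<omega> \<in> space M'. a < X (?\<iota> x) \<omega> - Y x \<omega>} \<in> sets M'" for x
      by (intro borel_measurable_less) auto
    then show ?thesis
      unfolding Bad_def using finite_unit_cube[OF \<epsilon>(1)] by (intro sets.finite_UN) auto
  qed
  ultimately have "prob G \<le> prob (G' \<union> Bad)"
    by (intro finite_measure_mono) auto
  also have "\<dots> \<le> prob G' + prob Bad"
    by (rule measure_Un_le[OF meas_G' meas_Bad])
  also have "prob Bad \<le> real (card ?K) * exp (u\<^sup>2 * v / 2 - u * a)"
    unfolding Bad_def
    by (rule finite_gaussian_family_max_tail[OF H'(1) finite_unit_cube[OF \<epsilon>(1)] Z _ u])
      (use v in \<open>simp add: X_def Y_def\<close>)
  also have "\<dots> \<le> (2 / \<epsilon>) ^ CARD('n) * exp (u\<^sup>2 * v / 2 - u * a)"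
    by (intro mult_right_mono card_unit_cube_le[OF \<epsilon>]) simp
  finally have "prob G \<le> prob G' + (2 / \<epsilon>) ^ CARD('n) * exp (u\<^sup>2 * v / 2 - u * a)"
    by simp
  moreover have "prob G = crossing_prob M h \<xi> \<alpha> \<epsilon>"
    unfolding crossing_prob_restriction[OF h h' n e(1) \<epsilon>(1)] G_def Y_def ..
  moreover have "prob G' = crossing_prob M' h' \<xi> (\<alpha> - \<xi> * \<delta>) \<epsilon>"
    unfolding crossing_prob_def lfpp_set_dist_eq_weighted box_average_eq G'_def X_def ..
  ultimately show ?thesis by (simp add: a_def)
qed

lemma Liminf_eq_1_perturb:
  fixes p q r :: "'a \<Rightarrow> real"
  assumes F: "F \<noteq> bot" and p: "Liminf F (\<lambda>x. ereal (p x)) = 1"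
    and le: "\<forall>\<^sub>F x in F. p x \<le> q x + r x" and r: "(r \<longlongrightarrow> 0) F" and q: "\<And>x. q x \<le> 1"
  shows "Liminf F (\<lambda>x. ereal (q x)) = 1"
proof (rule antisym)
  have "Liminf F (\<lambda>x. ereal (q x)) \<le> Limsup F (\<lambda>x. ereal (q x))"
    by (rule Liminf_le_Limsup[OF F])
  also have "\<dots> \<le> 1"
    by (rule Limsup_bounded) (use q in simp)
  finally show "Liminf F (\<lambda>x. ereal (q x)) \<le> 1" .
  show "1 \<le> Liminf F (\<lambda>x. ereal (q x))"
    unfolding le_Liminf_iff
  proof (intro allI impI)
    fix y :: ereal assume y: "y < 1"
    show "\<forall>\<^sub>F x in F. y < ereal (q x)"
    proof (cases y)
      case (real s)
      then have s: "s < 1" using y by simp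
      then have half: "ereal ((1 + s) / 2) < 1" by simp
      have "\<forall>y<1. \<forall>\<^sub>F x in F. y < ereal (p x)"
        unfolding le_Liminf_iff[symmetric] p by simp
      from this[rule_format, OF half]
      have "\<forall>\<^sub>F x in F. ereal ((1 + s) / 2) < ereal (p x)" .
      moreover have "\<forall>\<^sub>F x in F. r x < (1 - s) / 2"
        using s by (intro order_tendstoD(2)[OF r]) simp
      ultimately show ?thesis
        using le
      proof eventually_elim
        fix x assume "ereal ((1 + s) / 2) < ereal (p x)" "r x < (1 - s) / 2" "p x \<le> q x + r x"
        then show "y < ereal (q x)" by (simp add: real field_simps)
      qed
    qed (use y in auto)
  qed
qed

lemma scales_filter_not_bot: "at 0 within {\<epsilon>::real. 0 < \<epsilon> \<and> 1 / \<epsilon> \<in> \<nat>} \<noteq> bot"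
  unfolding trivial_limit_within not_not islimpt_approachable
proof (intro allI impI)
  fix d :: real assume "0 < d"
  then obtain k :: nat where "inverse (real (Suc k)) < d"
    using reals_Archimedean by blast
  then show "\<exists>x'\<in>{\<epsilon>::real. 0 < \<epsilon> \<and> 1 / \<epsilon> \<in> \<nat>}. x' \<noteq> 0 \<and> dist x' 0 < d"
    by (intro bexI[of _ "inverse (real (Suc k))"]) (auto simp: divide_inverse)
qed

lemma exists_embedding_fixing_Min:
  assumes "CARD('n::{finite,linorder}) \<le> CARD('m::{finite,linorder})"
  obtains e :: "'n::{finite,linorder} \<Rightarrow> 'm::{finite,linorder}" where "inj e" "e (Min UNIV) = Min UNIV"
proof -
  obtain f :: "'n \<Rightarrow> 'm" where f: "inj f"
    using assms inj_on_iff_card_le[of "UNIV :: 'n set" "UNIV :: 'm set"] by auto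
  show thesis
  proof
    show "inj (Transposition.transpose (f (Min UNIV)) (Min UNIV) \<circ> f)"
      using f by (intro inj_compose inj_transpose)
  qed simp
qed

theorem lemma1p4:
  fixes M :: "'w measure"
    and h :: "(real^'n::{finite,linorder}) signed_pair \<Rightarrow> 'w \<Rightarrow> real"
    and M' :: "'v measure"
    and h' :: "(real^'m::{finite,linorder}) signed_pair \<Rightarrow> 'v \<Rightarrow> real"
    and \<xi> :: real
  assumes "2 \<le> CARD('n)" and "CARD('n) < CARD('m)"
    and "0 \<le> \<xi>"
    and "whole_space_LGF M h"
    and "whole_space_LGF M' h'"
  shows "lfpp_exponent M' h' \<xi> \<ge> lfpp_exponent M h \<xi>"
proof -
  note n = assms(1) and \<xi> = assms(3) and h = assms(4) and h' = assms(5)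
  let ?Fi = "at 0 within {\<epsilon>::real. 0 < \<epsilon> \<and> 1 / \<epsilon> \<in> \<nat>}"
  obtain e :: "'n \<Rightarrow> 'm" where e: "inj e" "e (Min UNIV) = Min UNIV"
    using exists_embedding_fixing_Min[OF less_imp_le[OF assms(2)]] by blast
  have m: "2 \<le> CARD('m)" using assms by simp
  obtain v where v: "\<And>\<epsilon> x. 0 < \<epsilon> \<Longrightarrow>
    (\<integral>\<omega>. (h' (box_pair \<epsilon> (coord_embed e x)) \<omega> - h' (push_pair (coord_embed e) (box_pair \<epsilon> x)) \<omega>)\<^sup>2 \<partial>M') \<le> v"
    using box_average_increment_bounded[OF h' e(1) n m] by blast
  interpret M': prob_space M' by (rule LGF_D(1)[OF h'])
  have shift: "Liminf ?Fi (\<lambda>\<epsilon>. ereal (crossing_prob M' h' \<xi> (\<alpha> - \<xi> * \<delta>) \<epsilon>)) = 1"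
    if \<alpha>: "Liminf ?Fi (\<lambda>\<epsilon>. ereal (crossing_prob M h \<xi> \<alpha> \<epsilon>)) = 1" and \<delta>: "0 < \<delta>" for \<alpha> \<delta> :: real
  proof (rule Liminf_eq_1_perturb[OF scales_filter_not_bot \<alpha>])
    \<comment> \<open>With this \<open>u\<close> the tail is of order \<open>\<epsilon> ^ (n + 1)\<close>, one power better than the number of points.\<close>
    define u where "u = (real CARD('n) + 1) / \<delta>"
    define C where "C = 2 ^ CARD('n) * exp (u\<^sup>2 * v / 2)"
    have u: "0 \<le> u" "u * \<delta> = real CARD('n) + 1" using \<delta> by (auto simp: u_def)
    have "crossing_prob M h \<xi> \<alpha> \<epsilon> \<le> crossing_prob M' h' \<xi> (\<alpha> - \<xi> * \<delta>) \<epsilon> + C * \<epsilon>"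
      if \<epsilon>: "0 < \<epsilon>" "\<epsilon> < 1" for \<epsilon>
    proof -
      have "u * (\<delta> * ln (1 / \<epsilon>)) = - (real (Suc CARD('n)) * ln \<epsilon>)"
        using \<epsilon> u(2) by (simp add: ln_div mult.assoc[symmetric])
      then have "exp (u\<^sup>2 * v / 2 - u * (\<delta> * ln (1 / \<epsilon>))) = exp (u\<^sup>2 * v / 2) * exp (real (Suc CARD('n)) * ln \<epsilon>)"
        by (simp only: exp_add[symmetric] diff_minus_eq_add)
      also have "exp (real (Suc CARD('n)) * ln \<epsilon>) = \<epsilon> ^ Suc CARD('n)"
        using \<epsilon> by (simp only: exp_of_nat_mult exp_ln)
      finally have "(2 / \<epsilon>) ^ CARD('n) * exp (u\<^sup>2 * v / 2 - u * (\<delta> * ln (1 / \<epsilon>))) = C * \<epsilon>"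
        using \<epsilon> by (simp add: C_def power_divide)
      then show ?thesis
        using crossing_prob_le_higher_dimension[OF h h' n e \<epsilon>(1) _ \<xi> u(1) v[OF \<epsilon>(1)], of \<alpha> \<delta>] \<epsilon>
        by simp
    qed
    then show "\<forall>\<^sub>F \<epsilon> in ?Fi. crossing_prob M h \<xi> \<alpha> \<epsilon> \<le> crossing_prob M' h' \<xi> (\<alpha> - \<xi> * \<delta>) \<epsilon> + C * \<epsilon>"
      unfolding eventually_at by (intro exI[of _ 1]) auto
    show "((\<lambda>\<epsilon>. C * \<epsilon>) \<longlongrightarrow> 0) ?Fi"
      by (auto intro!: tendsto_eq_intros)
  qed (simp add: crossing_prob_def)
  show ?thesis
    unfolding lfpp_exponent_def
  proof (rule SUP_least)
    fix \<alpha> :: real assume "\<alpha> \<in> {\<alpha>. Liminf ?Fi (\<lambda>\<epsilon>. ereal (crossing_prob M h \<xi> \<alpha> \<epsilon>)) = 1}"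
    then have \<alpha>: "Liminf ?Fi (\<lambda>\<epsilon>. ereal (crossing_prob M h \<xi> \<alpha> \<epsilon>)) = 1" by simp
    let ?S = "SUP \<alpha> \<in> {\<alpha>::real. Liminf ?Fi (\<lambda>\<epsilon>. ereal (crossing_prob M' h' \<xi> \<alpha> \<epsilon>)) = 1}. ereal \<alpha>"
    show "ereal \<alpha> \<le> ?S"
    proof (rule ereal_le_epsilon2)
      fix \<eta> :: real assume \<eta>: "0 < \<eta>"
      \<comment> \<open>Dividing by \<open>\<xi> + 1\<close> rather than \<open>\<xi>\<close> covers \<open>\<xi> = 0\<close>.\<close>
      define \<delta> where "\<delta> = \<eta> / (\<xi> + 1)"
      have "0 < \<delta>" "\<xi> * \<delta> \<le> \<eta>"
        using \<eta> \<xi> by (auto simp: \<delta>_def field_simps)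
      have "ereal (\<alpha> - \<xi> * \<delta>) \<le> ?S"
        using shift[OF \<alpha> \<open>0 < \<delta>\<close>] by (intro SUP_upper) simp
      then have "ereal (\<alpha> - \<xi> * \<delta>) + ereal \<eta> \<le> ?S + ereal \<eta>"
        by (rule add_right_mono)
      moreover have "ereal \<alpha> \<le> ereal (\<alpha> - \<xi> * \<delta>) + ereal \<eta>"
        using \<open>\<xi> * \<delta> \<le> \<eta>\<close> by simp
      ultimately show "ereal \<alpha> \<le> ?S + ereal \<eta>" by (rule order.trans[rotated])
    qed
  qed
qed

end
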